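(* If $\phi\in L^2(\mathbb{R})$ is a wavelet and $(W^\alpha_\phi h)(a,b)$ is the general novel fractional wavelet transform (GNFrWT) of $h\in L^2(\mathbb{R})$, then the reconstruction of $h$ is given by $$h(t)=\frac{1}{C_\phi}\int_{\mathbb{R}}\int_{\mathbb{R}}(W^\alpha_\phi h)(a,b)\,\phi^\alpha_{a,b}(t)\,|a|^{2\rho-3}\,db\,da .$$
   Context: Here $\theta=\alpha\pi/2$ is the angle attached to the fractional order $\alpha$ (with $\cot\theta$ defined). For $a\in\mathbb{R}_+$, $b\in\mathbb{R}$ and $\rho\ge 0$ put $$\phi^{\alpha}_{a,b}(t)=e^{-\frac{i}{2}(t^2-b^2)\cot\theta}\,|a|^{-\rho}\,\phi\!\left(\frac{t-b}{a}\right).$$ The general novel fractional wavelet transform (GNFrWT) of a function $h$ with respect to the wavelet $\phi$ is $$(W^\alpha_\phi h)(a,b)=\int_{\mathbb{R}}h(t)\,\overline{\phi^\alpha_{a,b}(t)}\,dt .$$ The constant $C_\phi$ is assumed to satisfy $$0<C_\phi=\int_{\mathbb{R}}\frac{|\hat\phi(\omega)|^2}{|\omega|}\,d\omega<\infty ,$$ where $\hat\phi$ denotes the Fourier transform of $\phi$. *)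

theory Defs
  imports "HOL-Analysis.Analysis"
begin

definition square_integrable :: "(real \<Rightarrow> complex) \<Rightarrow> bool" where
  "square_integrable f \<longleftrightarrow>
     f \<in> borel_measurable lebesgue \<and> integrable lebesgue (\<lambda>x. (cmod (f x))\<^sup>2)"

definition L2_norm :: "(real \<Rightarrow> complex) \<Rightarrow> real" where
  "L2_norm f = sqrt (LINT x|lebesgue. (cmod (f x))\<^sup>2)"

text \<open>
  Membership of the approximants is required explicitly, because \<open>L2_norm\<close> takes a junk value
  outside \<open>L\<^sup>2\<close>.
\<close>

definition L2_tendsto ::
    "('i \<Rightarrow> real \<Rightarrow> complex) \<Rightarrow> (real \<Rightarrow> complex) \<Rightarrow> 'i filter \<Rightarrow> bool" where
  "L2_tendsto g f F \<longleftrightarrow>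
     square_integrable f \<and> (\<forall>\<^sub>F i in F. square_integrable (g i)) \<and>
     ((\<lambda>i. L2_norm (\<lambda>x. g i x - f x)) \<longlongrightarrow> 0) F"

text \<open>
  The Fourier transform on \<open>L\<^sup>2\<close> (Plancherel): the limit in \<open>L\<^sup>2\<close> of
  \<open>\<integral>\<^bsub>-r\<^esub>\<^bsup>r\<^esup> f t exp (- i \<omega> t) dt\<close> as \<open>r\<close> tends to infinity, without a factor in front. It is
  determined up to a null set, hence the choice of a representative. The normalisation matters:
  with the unitary factor \<open>1 / sqrt (2 \<pi>)\<close> the constant \<open>C_adm\<close> below would change by a factor
  \<open>2 \<pi>\<close>, and the reconstruction formula would be off by that factor.
\<close>

definition fourier_L2 :: "(real \<Rightarrow> complex) \<Rightarrow> real \<Rightarrow> complex" where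
  "fourier_L2 f =
     (SOME F. L2_tendsto (\<lambda>r \<omega>. LINT t:{-r..r}|lebesgue. f t * cis (- (\<omega> * t))) F at_top)"

definition C_adm :: "(real \<Rightarrow> complex) \<Rightarrow> real" where
  "C_adm \<phi> = (LINT \<omega>|lebesgue. (cmod (fourier_L2 \<phi> \<omega>))\<^sup>2 / \<bar>\<omega>\<bar>)"

definition wavelet :: "(real \<Rightarrow> complex) \<Rightarrow> bool" where
  "wavelet \<phi> \<longleftrightarrow>
     square_integrable \<phi> \<and>
     integrable lebesgue (\<lambda>\<omega>. (cmod (fourier_L2 \<phi> \<omega>))\<^sup>2 / \<bar>\<omega>\<bar>) \<and> 0 < C_adm \<phi>"

text \<open>
  The dilation parameter \<open>a\<close> ranges over all reals, since the reconstruction formula integrates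
  over negative \<open>a\<close> as well; the value at \<open>a = 0\<close> is irrelevant.
\<close>

definition frac_wavelet ::
    "real \<Rightarrow> real \<Rightarrow> (real \<Rightarrow> complex) \<Rightarrow> real \<Rightarrow> real \<Rightarrow> real \<Rightarrow> complex" where
  "frac_wavelet \<alpha> \<rho> \<phi> a b t =
     exp (- (\<i> / 2) * of_real ((t\<^sup>2 - b\<^sup>2) * cot (\<alpha> * pi / 2))) *
     of_real (\<bar>a\<bar> powr (- \<rho>)) * \<phi> ((t - b) / a)"

definition GNFrWT ::
    "real \<Rightarrow> real \<Rightarrow> (real \<Rightarrow> complex) \<Rightarrow> (real \<Rightarrow> complex) \<Rightarrow> real \<Rightarrow> real \<Rightarrow> complex" where
  "GNFrWT \<alpha> \<rho> \<phi> h a b = (LINT t|lebesgue. h t * cnj (frac_wavelet \<alpha> \<rho> \<phi> a b t))"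

text \<open>
  The formula \<open>h t = 1 / C \<integral>\<integral> \<dots> db da\<close> as an identity in \<open>L\<^sup>2\<close>. For general square-integrable
  \<open>h\<close> the outer integral need not converge absolutely at \<open>a = 0\<close> for a fixed \<open>t\<close>, so it is
  improper there: the two sides of \<open>0\<close> are cut off independently, the truncated integrals are
  honest Lebesgue integrals for every \<open>t\<close>, and their limit is taken in \<open>L\<^sup>2\<close>. Wherever the full
  integral does exist in the sense of Lebesgue, the formula has to hold literally, for almost
  every such \<open>t\<close>.
\<close>

definition reconstructs ::
    "real \<Rightarrow> (real \<Rightarrow> real \<Rightarrow> real \<Rightarrow> complex) \<Rightarrow> (real \<Rightarrow> complex) \<Rightarrow> bool" where
  "reconstructs C K h \<longleftrightarrow>
     (\<forall>t. AE a in lebesgue. integrable lebesgue (K t a)) \<and>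
     (\<forall>t. \<forall>\<delta>>0. \<forall>\<epsilon>>0.
        set_integrable lebesgue ({..-\<delta>} \<union> {\<epsilon>..}) (\<lambda>a. LINT b|lebesgue. K t a b)) \<and>
     L2_tendsto
       (\<lambda>(\<delta>, \<epsilon>) t. 1 / of_real C *
          (LINT a:{..-\<delta>} \<union> {\<epsilon>..}|lebesgue. LINT b|lebesgue. K t a b))
       h (at_right 0 \<times>\<^sub>F at_right 0) \<and>
     (AE t in lebesgue. integrable lebesgue (\<lambda>a. LINT b|lebesgue. K t a b) \<longrightarrow>
        h t = 1 / of_real C * (LINT a|lebesgue. LINT b|lebesgue. K t a b))"

end

(*
  Since |E| = 1 for the chirp E(t) = exp(-i t^2 cot(theta) / 2), the powers of |a| collapse to
  |a|^(-3), the chirps in b cancel, and the formula reduces to the classical Calderon formula for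
  g = h * cnj E. By Plancherel, the b-integral for fixed a multiplies the Fourier transform G of g
  by |Phi(a w)|^2 / |a|. Integrating over a in S, the multiplier becomes
  M_S(w) = integral over S of |Phi(a w)|^2 / |a| da, which is bounded by the admissibility constant
  C, because da / |a| is invariant under dilations. Away from a = 0 it also decays like 1/|w|, so
  that G * M_S is integrable and Fubini's theorem applies. As S exhausts the line, M_S tends to C,
  and the squared L2 error is (1 / 2 pi) * integral of |G|^2 (1 - M_S / C)^2, which tends to 0.
  The pointwise statement follows along a subsequence.
*)
theory Submission
  imports Defs "HOL-Probability.Probability"
begin

section \<open>Square-integrable Borel functions\<close>

text \<open>The statement lives on the completed Lebesgue measure, while Fubini's theorem is used on
  the product \<open>lborel \<Otimes>\<^sub>M lborel\<close>. The analysis is therefore carried out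
  for Borel functions, and an arbitrary square-integrable function is exchanged for a Borel
  representative only at the end. The Plancherel transform is treated as a relation
  \<open>is_ft\<close>, since a transform is fixed only up to a null set and the representative
  chosen by \<open>fourier_L2\<close> may fail to be Borel. Inversion enters only in mean square, by
  expanding the square of the error (\<open>energy_inversion\<close>).

  The factors \<open>2 * pi\<close> belong to the unnormalised transform: Plancherel and Parseval
  carry one each, the multiplication formula none. Writing the wavelet transform in frequency thus
  costs \<open>1 / (2 * pi)\<close>, and the integral over \<open>b\<close>, done by the
  multiplication formula, costs nothing. The single factor that remains is the one of the inversion
  formula, which leaves \<open>C\<close> as the only constant.\<close>

definition L2_borel :: "(real \<Rightarrow> complex) \<Rightarrow> bool" where
  "L2_borel f \<longleftrightarrow> f \<in> borel_measurable borel \<and> integrable lborel (\<lambda>x. (cmod (f x))\<^sup>2)"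

text \<open>The squared norm: Plancherel and polarisation are then identities without roots, and for
  most limits the triangle inequality with factors 2 (\<open>energy_triangle\<close>) is
  enough.\<close>

definition energy :: "(real \<Rightarrow> complex) \<Rightarrow> real" where
  "energy f = (LINT x|lborel. (cmod (f x))\<^sup>2)"

lemma L2_borel_measurable [measurable_dest]: "L2_borel f \<Longrightarrow> f \<in> borel_measurable borel"
  by (simp add: L2_borel_def)

lemma L2_borel_integrable: "L2_borel f \<Longrightarrow> integrable lborel (\<lambda>x. (cmod (f x))\<^sup>2)"
  by (simp add: L2_borel_def)

lemma energy_nonneg [simp]: "0 \<le> energy f"
  unfolding energy_def by simp

lemma L2_borel_bound:
  assumes "f \<in> borel_measurable borel" "integrable lborel g" "\<And>x. (cmod (f x))\<^sup>2 \<le> g x"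
  shows "L2_borel f"
  unfolding L2_borel_def
proof
  show "integrable lborel (\<lambda>x. (cmod (f x))\<^sup>2)"
    using assms(1) order_trans[OF assms(3) abs_ge_self]
    by (intro Bochner_Integration.integrable_bound[OF assms(2)]) (auto intro!: AE_I2)
qed fact

lemma cmod_add_square_le: "(cmod (a + b))\<^sup>2 \<le> 2 * (cmod a)\<^sup>2 + 2 * (cmod b)\<^sup>2"
proof -
  have "(cmod (a + b))\<^sup>2 \<le> (cmod a + cmod b)\<^sup>2"
    by (intro power_mono norm_triangle_ineq) auto
  also have "\<dots> \<le> 2 * (cmod a)\<^sup>2 + 2 * (cmod b)\<^sup>2"
    using zero_le_power2[of "cmod a - cmod b"] by (simp add: power2_eq_square algebra_simps)
  finally show ?thesis .
qed

lemma L2_borel_add: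
  assumes "L2_borel f" "L2_borel g" shows "L2_borel (\<lambda>x. f x + g x)"
  using assms cmod_add_square_le
  by (intro L2_borel_bound[where g = "\<lambda>x. 2 * (cmod (f x))\<^sup>2 + 2 * (cmod (g x))\<^sup>2"])
    (auto simp: L2_borel_def)

lemma L2_borel_cmult:
  assumes "L2_borel f" shows "L2_borel (\<lambda>x. c * f x)"
  using assms by (auto simp: L2_borel_def norm_mult power_mult_distrib)

lemma L2_borel_diff:
  assumes "L2_borel f" "L2_borel g" shows "L2_borel (\<lambda>x. f x - g x)"
  using L2_borel_add[OF assms(1) L2_borel_cmult[OF assms(2), of "-1"]] by simp

lemma borel_measurable_cnj [measurable (raw)]:
  "f \<in> borel_measurable M \<Longrightarrow> (\<lambda>x. cnj (f x)) \<in> borel_measurable M"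
  by (intro borel_measurable_continuous_on[OF continuous_on_cnj[OF continuous_on_id]])

lemma L2_borel_cnj: "L2_borel f \<Longrightarrow> L2_borel (\<lambda>x. cnj (f x))"
  by (auto simp: L2_borel_def)

lemma energy_add_le:
  assumes "L2_borel f" "L2_borel g"
  shows "energy (\<lambda>x. f x + g x) \<le> 2 * energy f + 2 * energy g"
proof -
  have "energy (\<lambda>x. f x + g x) \<le> (LINT x|lborel. 2 * (cmod (f x))\<^sup>2 + 2 * (cmod (g x))\<^sup>2)"
    unfolding energy_def
    using L2_borel_integrable[OF assms(1)] L2_borel_integrable[OF assms(2)]
      L2_borel_integrable[OF L2_borel_add[OF assms]] cmod_add_square_le
    by (intro integral_mono) auto
  then show ?thesis
    using L2_borel_integrable[OF assms(1)] L2_borel_integrable[OF assms(2)]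
    by (simp add: energy_def)
qed

lemma energy_minus [simp]: "energy (\<lambda>x. - f x) = energy f"
  by (simp add: energy_def)

lemma energy_diff_commute: "energy (\<lambda>x. f x - g x) = energy (\<lambda>x. g x - f x)"
  by (simp add: energy_def norm_minus_commute)

lemma energy_triangle:
  assumes "L2_borel f" "L2_borel g" "L2_borel h"
  shows "energy (\<lambda>x. f x - h x) \<le> 2 * energy (\<lambda>x. f x - g x) + 2 * energy (\<lambda>x. g x - h x)"
  using energy_add_le[OF L2_borel_diff[OF assms(1,2)] L2_borel_diff[OF assms(2,3)]] by simp

lemma L2_borel_mult_integrable:
  assumes "L2_borel f" "L2_borel g"
  shows "integrable lborel (\<lambda>x. f x * g x)"
proof (rule Bochner_Integration.integrable_bound)
  show "integrable lborel (\<lambda>x. (cmod (f x))\<^sup>2 + (cmod (g x))\<^sup>2)"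
    using assms by (auto simp: L2_borel_def)
  show "(\<lambda>x. f x * g x) \<in> borel_measurable lborel" using assms by (auto simp: L2_borel_def)
  have "a * b \<le> a\<^sup>2 + b\<^sup>2" if "a \<ge> 0" "b \<ge> 0" for a b :: real
    using sum_squares_bound[of a b] mult_nonneg_nonneg[OF that] by linarith
  then show "AE x in lborel. norm (f x * g x) \<le> norm ((cmod (f x))\<^sup>2 + (cmod (g x))\<^sup>2)"
    by (simp add: norm_mult)
qed

lemma energy_0_AE:
  assumes "L2_borel f" "energy f = 0" shows "AE x in lborel. f x = 0"
  using assms integral_nonneg_eq_0_iff_AE[OF L2_borel_integrable[OF assms(1)]]
  by (auto simp: energy_def)

text \<open>The pointwise inequality behind it is \<open>2 * (x * B) * (y * A) \<le> (x * B)\<^sup>2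
  + (y * A)\<^sup>2\<close>, with \<open>A\<close> and \<open>B\<close> the two norms, divided by
  \<open>2 * A * B\<close>. The case of a vanishing norm is split off because the weights divide by
  it.\<close>

lemma L2_Cauchy_Schwarz:
  assumes "L2_borel f" "L2_borel g"
  shows "cmod (LINT x|lborel. f x * g x) \<le> sqrt (energy f) * sqrt (energy g)"
proof -
  let ?I = "LINT x|lborel. cmod (f x) * cmod (g x)"
  have int: "integrable lborel (\<lambda>x. cmod (f x) * cmod (g x))"
    using integrable_norm[OF L2_borel_mult_integrable[OF assms]] by (simp add: norm_mult)
  have le: "cmod (LINT x|lborel. f x * g x) \<le> ?I"
    using integral_norm_bound[of lborel "\<lambda>x. f x * g x"] by (simp add: norm_mult)
  show ?thesis
  proof (cases "energy f = 0 \<or> energy g = 0")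
    case True
    then have "AE x in lborel. f x * g x = 0"
      using energy_0_AE[OF assms(1)] energy_0_AE[OF assms(2)] by auto
    then have "(LINT x|lborel. f x * g x) = 0"
      by (simp add: integral_eq_zero_AE)
    then show ?thesis by simp
  next
    case False
    define A B where "A = sqrt (energy f)" and "B = sqrt (energy g)"
    have pos: "A > 0" "B > 0" using False energy_nonneg[of f] energy_nonneg[of g]
      by (auto simp: A_def B_def less_le)
    have sq: "A\<^sup>2 = energy f" "B\<^sup>2 = energy g" by (auto simp: A_def B_def)
    have "?I \<le> (LINT x|lborel. (B / (2 * A)) * (cmod (f x))\<^sup>2 + (A / (2 * B)) * (cmod (g x))\<^sup>2)"
    proof (rule integral_mono[OF int])
      show "integrable lborel (\<lambda>x. (B / (2 * A)) * (cmod (f x))\<^sup>2 + (A / (2 * B)) * (cmod (g x))\<^sup>2)"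
        using assms by (auto simp: L2_borel_def)
      fix x
      have "2 * (cmod (f x) * B) * (cmod (g x) * A) \<le> (cmod (f x) * B)\<^sup>2 + (cmod (g x) * A)\<^sup>2"
        by (rule sum_squares_bound)
      then show "cmod (f x) * cmod (g x) \<le> (B / (2 * A)) * (cmod (f x))\<^sup>2 + (A / (2 * B)) * (cmod (g x))\<^sup>2"
        using pos by (simp add: field_simps power2_eq_square)
    qed
    also have "\<dots> = (B / (2 * A)) * energy f + (A / (2 * B)) * energy g"
      using assms by (simp add: L2_borel_def energy_def)
    also have "\<dots> = A * B" using pos by (simp add: sq[symmetric] field_simps power2_eq_square)
    finally show ?thesis using le by (simp add: A_def B_def)
  qed
qed

lemma energy_eq_integral:
  assumes "L2_borel f"
  shows "complex_of_real (energy f) = (LINT x|lborel. f x * cnj (f x))"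
  by (simp add: energy_def complex_norm_square[symmetric] flip: integral_complex_of_real)

lemma L2_inner_tendsto:
  assumes "\<And>n. L2_borel (f n)" "L2_borel f'" "((\<lambda>n. energy (\<lambda>x. f n x - f' x)) \<longlongrightarrow> 0) F"
    and "L2_borel g"
  shows "((\<lambda>n. LINT x|lborel. f n x * g x) \<longlongrightarrow> (LINT x|lborel. f' x * g x)) F"
proof -
  have "((\<lambda>n. sqrt (energy (\<lambda>x. f n x - f' x)) * sqrt (energy g)) \<longlongrightarrow> sqrt 0 * sqrt (energy g)) F"
    by (intro tendsto_intros assms)
  moreover have "cmod ((LINT x|lborel. f n x * g x) - (LINT x|lborel. f' x * g x))
      \<le> sqrt (energy (\<lambda>x. f n x - f' x)) * sqrt (energy g)" for n
  proof -
    have "(LINT x|lborel. f n x * g x) - (LINT x|lborel. f' x * g x)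
      = (LINT x|lborel. (f n x - f' x) * g x)"
      using L2_borel_mult_integrable assms by (simp add: left_diff_distrib)
    then show ?thesis using L2_Cauchy_Schwarz[OF L2_borel_diff[OF assms(1,2)] assms(4)] by simp
  qed
  ultimately have "((\<lambda>n. (LINT x|lborel. f n x * g x) - (LINT x|lborel. f' x * g x)) \<longlongrightarrow> 0) F"
    by (rule_tac Lim_null_comparison[OF always_eventually]) auto
  then show ?thesis by (rule LIM_zero_cancel)
qed

lemma energy_add:
  assumes "L2_borel f" "L2_borel g"
  shows "energy (\<lambda>x. f x + g x) = energy f + 2 * Re (LINT x|lborel. f x * cnj (g x)) + energy g"
proof -
  let ?I = "LINT x|lborel. f x * cnj (g x)"
  note i = L2_borel_mult_integrable L2_borel_cnj assms
  have "complex_of_real (energy (\<lambda>x. f x + g x)) =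
     (LINT x|lborel. f x * cnj (f x) + (f x * cnj (g x) + cnj (f x * cnj (g x))) + g x * cnj (g x))"
    unfolding energy_eq_integral[OF L2_borel_add[OF assms]]
    by (intro Bochner_Integration.integral_cong) (auto simp: algebra_simps)
  also have "\<dots> = (LINT x|lborel. f x * cnj (f x)) + (?I + cnj ?I) + (LINT x|lborel. g x * cnj (g x))"
  proof -
    have "integrable lborel (\<lambda>x. f x * cnj (f x))" "integrable lborel (\<lambda>x. g x * cnj (g x))"
      "integrable lborel (\<lambda>x. f x * cnj (g x))" using i by blast+
    moreover have "integrable lborel (\<lambda>x. cnj (f x * cnj (g x)))" 
      using calculation by (intro integrable_cnj)
    ultimately show ?thesis by (simp del: complex_cnj_mult flip: integral_cnj)
  qed
  also have "\<dots> = complex_of_real (energy f + 2 * Re ?I + energy g)"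
    by (simp add: energy_eq_integral[symmetric] assms complex_add_cnj)
  finally show ?thesis
    using of_real_eq_iff by blast
qed

text \<open>The triangle inequality with constant 1. \<open>energy_tendsto\<close> depends on it:
  with the factors 2 of \<open>energy_triangle\<close>, nearby functions would only have comparable
  energies.\<close>

lemma energy_norm_triangle:
  assumes "L2_borel f" "L2_borel g"
  shows "sqrt (energy (\<lambda>x. f x + g x)) \<le> sqrt (energy f) + sqrt (energy g)"
proof -
  let ?I = "LINT x|lborel. f x * cnj (g x)"
  have "energy (\<lambda>x. f x + g x) = energy f + 2 * Re ?I + energy g"
    by (rule energy_add[OF assms])
  also have "\<dots> \<le> energy f + 2 * (sqrt (energy f) * sqrt (energy g)) + energy g"
    using L2_Cauchy_Schwarz[OF assms(1) L2_borel_cnj[OF assms(2)]] complex_Re_le_cmod[of ?I]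
    by (simp add: energy_def)
  also have "\<dots> = (sqrt (energy f) + sqrt (energy g))\<^sup>2"
    by (simp add: power2_sum)
  finally show ?thesis by (simp add: real_le_lsqrt)
qed

lemma energy_null_comparison:
  assumes "(a \<longlongrightarrow> 0) F" "\<And>n. energy (u n) \<le> a n"
  shows "((\<lambda>n. energy (u n)) \<longlongrightarrow> 0) F"
  using assms by (rule_tac Lim_null_comparison[OF always_eventually]) auto

lemma energy_cmult: "energy (\<lambda>x. c * f x) = (cmod c)\<^sup>2 * energy f"
  by (simp add: energy_def norm_mult power_mult_distrib)

lemma energy_tendsto:
  assumes "\<And>n. L2_borel (f n)" "L2_borel f'" "((\<lambda>n. energy (\<lambda>x. f n x - f' x)) \<longlongrightarrow> 0) F"
  shows "((\<lambda>n. energy (f n)) \<longlongrightarrow> energy f') F"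
proof -
  have *: "\<bar>sqrt (energy (f n)) - sqrt (energy f')\<bar> \<le> sqrt (energy (\<lambda>x. f n x - f' x))" for n
    using energy_norm_triangle[OF L2_borel_diff[OF assms(1)[of n] assms(2)] assms(2)]
      energy_norm_triangle[OF L2_borel_diff[OF assms(2) assms(1)[of n]] assms(1)[of n]]
      energy_diff_commute[of f' "f n"]
    by simp
  have "((\<lambda>n. sqrt (energy (\<lambda>x. f n x - f' x))) \<longlongrightarrow> sqrt 0) F"
    by (intro tendsto_intros assms)
  then have "((\<lambda>n. sqrt (energy (f n)) - sqrt (energy f')) \<longlongrightarrow> 0) F"
    using * by (rule_tac Lim_null_comparison[OF always_eventually]) auto
  from tendsto_power[OF LIM_zero_cancel[OF this], of 2] show ?thesis by simp
qed

section \<open>Continuity of translation\<close>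

lemma L2_borel_affine:
  assumes "L2_borel f" "c \<noteq> 0"
  shows "L2_borel (\<lambda>x. f (t + c * x))" "energy (\<lambda>x. f (t + c * x)) = energy f / \<bar>c\<bar>"
proof -
  have [measurable]: "f \<in> borel_measurable borel" using assms(1) by measurable
  show "L2_borel (\<lambda>x. f (t + c * x))"
    using lborel_integrable_real_affine[OF L2_borel_integrable[OF assms(1)] assms(2), of t]
    by (simp add: L2_borel_def)
  show "energy (\<lambda>x. f (t + c * x)) = energy f / \<bar>c\<bar>"
    using lborel_integral_real_affine[OF assms(2), of "\<lambda>x. (cmod (f x))\<^sup>2" t] assms(2)
    by (simp add: energy_def)
qed

lemma L2_borel_translate:
  assumes "L2_borel f"
  shows "L2_borel (\<lambda>x. f (x + s))" "energy (\<lambda>x. f (x + s)) = energy f"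
  using L2_borel_affine[OF assms, of 1 s] by (simp_all add: add.commute)

text \<open>The limit inherits the bound \<open>w\<close> almost everywhere, so
  \<open>4 * (w x)\<^sup>2\<close> dominates the squared differences.\<close>

lemma energy_dominated_convergence:
  fixes f :: "nat \<Rightarrow> real \<Rightarrow> complex"
  assumes [measurable]: "\<And>n. f n \<in> borel_measurable borel" "f' \<in> borel_measurable borel"
    and lim: "AE x in lborel. (\<lambda>n. f n x) \<longlonglongrightarrow> f' x"
    and bound: "\<And>n x. cmod (f n x) \<le> w x"
    and w: "integrable lborel (\<lambda>x. (w x)\<^sup>2)"
  shows "(\<lambda>n. energy (\<lambda>x. f n x - f' x)) \<longlonglongrightarrow> 0"
proof -
  have "(\<lambda>n. LINT x|lborel. (cmod (f n x - f' x))\<^sup>2) \<longlonglongrightarrow> (LINT x::real|lborel. 0)"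
  proof (rule integral_dominated_convergence)
    show "integrable lborel (\<lambda>x. 4 * (w x)\<^sup>2)" using w by simp
    show "AE x in lborel. (\<lambda>n. (cmod (f n x - f' x))\<^sup>2) \<longlonglongrightarrow> 0"
      using lim
    proof eventually_elim
      case (elim x)
      from tendsto_power[OF tendsto_norm[OF LIM_zero[OF elim]], of 2] show ?case by simp
    qed
    show "AE x in lborel. norm ((cmod (f n x - f' x))\<^sup>2) \<le> 4 * (w x)\<^sup>2" for n
      using lim
    proof eventually_elim
      case (elim x)
      have "cmod (f' x) \<le> w x"
        by (rule LIMSEQ_le_const2[OF tendsto_norm[OF elim]]) (use bound in auto)
      then have "cmod (f n x - f' x) \<le> 2 * w x"
        using bound[of n x] norm_triangle_ineq4[of "f n x" "f' x"] by linarith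
      from power_mono[OF this, of 2] show ?case by (simp add: power_mult_distrib)
    qed
  qed auto
  then show ?thesis by (simp add: energy_def)
qed

lemma integrable_square_indicator_interval:
  "integrable lborel (\<lambda>x::real. (c * indicator {a..b} x)\<^sup>2 :: real)"
proof -
  have "(\<lambda>x::real. (c * indicator {a..b} x)\<^sup>2 :: real) = (\<lambda>x. c\<^sup>2 * indicator {a..b} x)"
    by (auto simp: indicator_def)
  moreover have "integrable lborel (\<lambda>x::real. c\<^sup>2 * indicator {a..b} x :: real)"
    by (intro integrable_mult_right integrable_real_indicator) (auto simp: emeasure_lborel_Icc_eq)
  ultimately show ?thesis by simp
qed

text \<open>Clipping the values and cutting off at infinity come first, so that the second
  approximation, by continuous functions converging only almost everywhere, has a bounded dominating
  function of compact support. Clipping is itself continuous, so it can be applied to the continuous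
  approximants \<open>g n\<close> as well.\<close>

lemma energy_dense_continuous:
  assumes "L2_borel f" "e > 0"
  obtains g R B where "continuous_on UNIV g" "\<And>x. \<bar>x\<bar> > R \<Longrightarrow> g x = 0" "\<And>x. cmod (g x) \<le> B"
    "L2_borel g" "energy (\<lambda>x. f x - g x) < e"
proof -
  have [measurable]: "f \<in> borel_measurable borel" using assms(1) by measurable
  \<comment> \<open>\<open>T k\<close> is the radial retraction onto the disc of radius
    \<open>k\<close>. For \<open>k = 0\<close> division by zero makes it the identity, whence
    \<open>k > 0\<close> in the bound \<open>Tk\<close>.\<close>
  define T where "T k z = z / of_real (max 1 (cmod z / real k))" for k :: nat and z
  define cut where "cut k x = max 0 (min 1 (real k - \<bar>x\<bar>))" for k :: nat and x :: real
  have contT: "continuous_on UNIV (T k)" for k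
  proof (cases "k = 0")
    case False
    have "max 1 y \<noteq> 0" for y :: real by (simp add: max_def)
    with False show ?thesis unfolding T_def by (intro continuous_intros) auto
  qed (simp add: T_def)
  have contcut: "continuous_on UNIV (cut k)" for k
    unfolding cut_def by (intro continuous_intros)
  have [measurable]: "cut k \<in> borel_measurable borel" "T k \<in> borel_measurable borel" for k
    using contT contcut by (auto intro: borel_measurable_continuous_onI)
  have cut: "0 \<le> cut k x" "cut k x \<le> 1" "cut k x \<noteq> 0 \<Longrightarrow> \<bar>x\<bar> \<le> k" for k x
    by (auto simp: cut_def max_def min_def split: if_splits)
  have Tle: "cmod (T k z) \<le> cmod z" for k z
  proof -
    have "cmod z / max 1 (cmod z / real k) \<le> cmod z / 1" by (intro divide_left_mono) auto
    then show ?thesis by (simp add: T_def norm_divide)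
  qed
  have Tk: "cmod (T k z) \<le> real k" if "k > 0" for k z
  proof -
    have "cmod z \<le> real k * max 1 (cmod z / real k)" using that by (simp add: max_def field_simps)
    then show ?thesis by (simp add: T_def norm_divide divide_le_eq max_def)
  qed
  have Tlim: "(\<lambda>k. T k z) \<longlonglongrightarrow> z" for z
  proof -
    obtain K :: nat where K: "cmod z \<le> real K" using real_arch_simple by blast
    have "T k z = z" if "k \<ge> max 1 K" for k
    proof -
      have "cmod z \<le> real k" "0 < real k" using K that by (auto intro: order_trans)
      then have "cmod z / real k \<le> 1" by (simp add: divide_le_eq)
      then show ?thesis by (simp add: T_def max_absorb1)
    qed
    then show ?thesis
      by (intro tendsto_eventually) (meson eventually_sequentiallyI)
  qed
  have cutlim: "(\<lambda>k. cut k x) \<longlonglongrightarrow> 1" for x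
  proof -
    obtain K :: nat where "\<bar>x\<bar> + 1 \<le> real K" using real_arch_simple by blast
    then have "cut k x = 1" if "k \<ge> K" for k
      using that by (simp add: cut_def max_def min_def)
    then show ?thesis
      by (intro tendsto_eventually) (meson eventually_sequentiallyI)
  qed
  have "(\<lambda>k. energy (\<lambda>x. of_real (cut k x) * T k (f x) - f x)) \<longlonglongrightarrow> 0"
  proof (rule energy_dominated_convergence[where w = "\<lambda>x. cmod (f x)"])
    show "AE x in lborel. (\<lambda>k. of_real (cut k x) * T k (f x)) \<longlonglongrightarrow> f x"
    proof (rule AE_I2)
      fix x from tendsto_mult[OF tendsto_of_real[OF cutlim, of x] Tlim[of "f x"]]
      show "(\<lambda>k. of_real (cut k x) * T k (f x)) \<longlonglongrightarrow> f x" by simp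
    qed
    show "cmod (of_real (cut k x) * T k (f x)) \<le> cmod (f x)" for k x
      using mult_mono[OF cut(2)[of k x] Tle[of k "f x"]] cut(1)[of k x] by (simp add: norm_mult)
  qed (use assms in \<open>auto simp: L2_borel_def\<close>)
  \<comment> \<open>A quarter of \<open>e\<close> for each of the two approximations, since
    \<open>energy_triangle\<close> doubles both errors.\<close>
  then have "\<forall>\<^sub>F k in sequentially. energy (\<lambda>x. of_real (cut k x) * T k (f x) - f x) < e / 4"
    using assms(2) by (intro order_tendstoD(2)[of _ 0]) auto
  from eventually_conj[OF this eventually_gt_at_top[of 0]]
  obtain k where k: "energy (\<lambda>x. of_real (cut k x) * T k (f x) - f x) < e / 4" "k > 0"
    using eventually_happens by force
  \<comment> \<open>Source of the continuous functions: a measurable function is a pointwise limit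
    of continuous ones off a negligible set.\<close>
  have "f measurable_on UNIV"
    by (rule lebesgue_measurable_imp_measurable_on) (auto intro: measurable_completion)
  then obtain N g where N: "negligible N" "\<And>n::nat. continuous_on UNIV (g n)"
      "\<And>x. x \<notin> N \<Longrightarrow> (\<lambda>n. g n x) \<longlonglongrightarrow> f x"
    unfolding measurable_on_def by auto
  have [measurable]: "g n \<in> borel_measurable borel" for n
    using N(2) by (auto intro: borel_measurable_continuous_onI)
  have AEN: "AE x in lborel. x \<notin> N"
    using AE_not_in[of N lebesgue] N(1) by (simp add: negligible_iff_null_sets AE_completion_iff)
  define w where "w x = real k * indicator {-real k..real k} x" for x :: real
  have w: "integrable lborel (\<lambda>x. (w x)\<^sup>2)" unfolding w_def by (rule integrable_square_indicator_interval)
  have le: "cmod (of_real (cut k x) * T k z) \<le> w x" for x z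
    using mult_mono[OF cut(2)[of k x] Tk[OF k(2), of z]] cut(1,3)[of k x]
    by (cases "cut k x = 0") (auto simp: norm_mult w_def indicator_def abs_le_iff)
  have "(\<lambda>n. energy (\<lambda>x. of_real (cut k x) * T k (g n x) - of_real (cut k x) * T k (f x))) \<longlonglongrightarrow> 0"
  proof (rule energy_dominated_convergence[OF _ _ _ le w])
    show "AE x in lborel. (\<lambda>n. of_real (cut k x) * T k (g n x)) \<longlonglongrightarrow> of_real (cut k x) * T k (f x)"
      using AEN
    proof eventually_elim
      case (elim x)
      have "isCont (T k) (f x)" using contT by (simp add: continuous_on_eq_continuous_at)
      from tendsto_mult[OF tendsto_const isCont_tendsto_compose[OF this N(3)[OF elim]]] show ?case .
    qed
  qed measurable
  then have "\<forall>\<^sub>F n in sequentially. energy (\<lambda>x. of_real (cut k x) * T k (g n x) - of_real (cut k x) * T k (f x)) < e / 4"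
    using assms(2) by (intro order_tendstoD(2)[of _ 0]) auto
  then obtain n where n: "energy (\<lambda>x. of_real (cut k x) * T k (g n x) - of_real (cut k x) * T k (f x)) < e / 4"
    using eventually_happens by force
  define G where "G x = of_real (cut k x) * T k (g n x)" for x
  have L2: "L2_borel (\<lambda>x. of_real (cut k x) * T k (f x))" "L2_borel G"
    unfolding G_def using le by (auto intro!: L2_borel_bound[OF _ w] power_mono)
  show thesis
  proof
    show "continuous_on UNIV G" unfolding G_def
      by (intro continuous_intros contcut continuous_on_compose2[OF contT N(2)]) auto
    show "G x = 0" if "\<bar>x\<bar> > real k" for x using cut(3)[of k x] that by (auto simp: G_def)
    show "cmod (G x) \<le> real k" for x
      using le[of x "g n x"] by (auto simp: G_def w_def indicator_def split: if_splits intro: order_trans)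
    show "L2_borel G" by fact
    show "energy (\<lambda>x. f x - G x) < e"
      using energy_triangle[OF assms(1) L2] k(1) n
      unfolding G_def[symmetric] by (subst (asm) (2 3) energy_diff_commute) linarith
  qed
qed

text \<open>For a continuous \<open>g\<close> vanishing outside an interval, shifts by a bounded
  sequence stay below one fixed multiple of an indicator, so dominated convergence applies; density
  and the translation invariance of \<open>energy\<close> do the rest.\<close>

lemma energy_translate_tendsto:
  fixes s :: "nat \<Rightarrow> real"
  assumes f: "L2_borel f" and s: "s \<longlonglongrightarrow> 0"
  shows "(\<lambda>n. energy (\<lambda>x. f (x + s n) - f x)) \<longlonglongrightarrow> 0"
proof (rule order_tendstoI)
  fix e :: real assume "0 < e"
  \<comment> \<open>Two applications of \<open>energy_triangle\<close> lead to
    \<open>2 * (e / 16) + 4 * (e / 8) + 4 * (e / 16)\<close>, which is less than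
    \<open>e\<close>.\<close>
  then obtain g R B where g: "continuous_on UNIV g" "\<And>x. \<bar>x\<bar> > R \<Longrightarrow> g x = 0"
     "\<And>x. cmod (g x) \<le> B" "L2_borel g" "energy (\<lambda>x. f x - g x) < e / 16"
    using energy_dense_continuous[OF f, of "e / 16"] by auto
  have [measurable]: "g \<in> borel_measurable borel" using g(4) by measurable
  obtain S where S: "\<And>n. \<bar>s n\<bar> \<le> S"
    using convergent_imp_Bseq[OF convergentI[OF s]] by (auto simp: Bseq_def)
  define w where "w x = B * indicator {-(R + S)..R + S} x" for x :: real
  have B: "B \<ge> 0" using g(3)[of 0] norm_ge_zero order_trans by blast
  have le: "cmod (g (x + s n)) \<le> w x" for x n
    using g(3)[of "x + s n"] g(2)[of "x + s n"] S[of n] B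
    by (cases "\<bar>x + s n\<bar> > R") (auto simp: w_def indicator_def)
  have "(\<lambda>n. energy (\<lambda>x. g (x + s n) - g x)) \<longlonglongrightarrow> 0"
  proof (rule energy_dominated_convergence[OF _ _ _ le])
    show "AE x in lborel. (\<lambda>n. g (x + s n)) \<longlonglongrightarrow> g x"
    proof (rule AE_I2)
      fix x
      have "isCont g x" using g(1) by (simp add: continuous_on_eq_continuous_at)
      moreover have "(\<lambda>n. x + s n) \<longlonglongrightarrow> x" using tendsto_add[OF tendsto_const s, of x] by simp
      ultimately show "(\<lambda>n. g (x + s n)) \<longlonglongrightarrow> g x" by (rule isCont_tendsto_compose)
    qed
    show "integrable lborel (\<lambda>x. (w x)\<^sup>2)" unfolding w_def by (rule integrable_square_indicator_interval)
  qed measurable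
  then have "\<forall>\<^sub>F n in sequentially. energy (\<lambda>x. g (x + s n) - g x) < e / 8"
    using \<open>0 < e\<close> by (intro order_tendstoD(2)[of _ 0]) auto
  then show "\<forall>\<^sub>F n in sequentially. energy (\<lambda>x. f (x + s n) - f x) < e"
  proof eventually_elim
    case (elim n)
    have 1: "energy (\<lambda>x. f (x + s n) - g (x + s n)) = energy (\<lambda>x. f x - g x)"
      using L2_borel_translate(2)[OF L2_borel_diff[OF f g(4)]] by simp
    note t = L2_borel_translate(1)[OF f, of "s n"] L2_borel_translate(1)[OF g(4), of "s n"]
    show ?case
      using energy_triangle[OF t f] energy_triangle[OF t(2) g(4) f] elim g(5) 1
        energy_diff_commute[of g f] \<open>0 < e\<close> by linarith
  qed
qed (use energy_nonneg in \<open>auto intro!: always_eventually intro: less_le_trans\<close>)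

lemma correlation_tendsto:
  fixes s :: "nat \<Rightarrow> real"
  assumes f: "L2_borel f" and s: "s \<longlonglongrightarrow> 0"
  shows "(\<lambda>n. LINT x|lborel. f (x + s n) * cnj (f x)) \<longlonglongrightarrow> complex_of_real (energy f)"
  unfolding energy_eq_integral[OF f]
  by (intro L2_inner_tendsto L2_borel_translate f L2_borel_cnj energy_translate_tendsto s)

section \<open>Plancherel on the intersection of the two Lebesgue spaces\<close>

definition ft :: "(real \<Rightarrow> complex) \<Rightarrow> real \<Rightarrow> complex" where
  "ft f w = (LINT t|lborel. f t * cis (- (w * t)))"

lemma borel_measurable_cis [measurable (raw)]:
  "f \<in> borel_measurable M \<Longrightarrow> (\<lambda>x. cis (f x)) \<in> borel_measurable M"
  by (rule borel_measurable_continuous_on) (auto intro!: continuous_intros)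

lemma integrable_mult_cis:
  fixes f :: "real \<Rightarrow> complex"
  assumes "integrable lborel f" "g \<in> borel_measurable borel"
  shows "integrable lborel (\<lambda>t. f t * cis (g t))"
  using assms by (intro Bochner_Integration.integrable_bound[OF assms(1)]) (auto simp: norm_mult)

lemma borel_measurable_ft [measurable]:
  assumes [measurable]: "f \<in> borel_measurable borel"
  shows "ft f \<in> borel_measurable borel"
proof -
  have "(\<lambda>w. LINT t|lborel. f t * cis (- (w * t))) \<in> borel_measurable borel"
    by measurable
  then show ?thesis by (simp add: ft_def[abs_def])
qed

lemma cmod_ft_le: "cmod (ft f w) \<le> (LINT t|lborel. cmod (f t))"
  using integral_norm_bound[of lborel "\<lambda>t. f t * cis (- (w * t))"] by (simp add: ft_def norm_mult)

text \<open>The kernel \<open>cis (- (w * t))\<close> is symmetric in \<open>w\<close> and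
  \<open>t\<close>, so Fubini's theorem moves the transform from one factor to the other.\<close>

lemma ft_multiplication:
  assumes f: "integrable lborel f" and g: "integrable lborel g"
  shows "(LINT w|lborel. ft f w * g w) = (LINT t|lborel. f t * ft g t)"
proof -
  have [measurable]: "f \<in> borel_measurable borel" "g \<in> borel_measurable borel" using f g by auto
  let ?F = "\<lambda>w t. f t * g w * cis (- (w * t))"
  have i: "integrable (lborel \<Otimes>\<^sub>M lborel) (case_prod ?F)"
  proof (rule lborel_pair.Fubini_integrable)
    show "integrable lborel (\<lambda>w. LINT t|lborel. norm (case (w, t) of (w, t) \<Rightarrow> ?F w t))"
      using g by (simp add: norm_mult)
    have "integrable lborel (\<lambda>t. f t * g w * cis (- (w * t)))" for w
      using f by (intro integrable_mult_cis integrable_mult_left) auto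
    then show "AE w in lborel. integrable lborel (\<lambda>t. case (w, t) of (w, t) \<Rightarrow> ?F w t)" by simp
  qed measurable
  have "(LINT w|lborel. ft f w * g w) = (LINT w|lborel. LINT t|lborel. ?F w t)"
    unfolding ft_def by (simp flip: integral_mult_left_zero integral_mult_right_zero add: mult_ac)
  also have "\<dots> = (LINT t|lborel. LINT w|lborel. ?F w t)"
    using lborel_pair.Fubini_integral[OF i] by simp
  also have "\<dots> = (LINT t|lborel. f t * ft g t)"
    unfolding ft_def by (simp flip: integral_mult_left_zero integral_mult_right_zero add: mult_ac)
  finally show ?thesis .
qed

lemma ft_scale:
  assumes "s > 0"
  shows "ft (\<lambda>t. f (s * t)) w = ft f (w / s) / of_real s"
  using lborel_integral_real_affine[of s "\<lambda>t. f t * cis (- (w / s * t))" 0] assms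
  by (simp add: ft_def scaleR_conv_of_real)

section \<open>The Gaussian and its transform\<close>

definition gauss :: "real \<Rightarrow> real" where
  "gauss x = exp (- x\<^sup>2 / 2)"

lemma gauss_eq: "gauss x = sqrt (2 * pi) * std_normal_density x"
  by (simp add: gauss_def normal_density_def)

lemma gauss_integrable: "integrable lborel gauss"
  using integrable_normal_moment[of 1 0 0]
  by (simp add: gauss_eq[abs_def])

lemma gauss_integral: "(LINT x|lborel. gauss x) = sqrt (2 * pi)"
  by (simp add: gauss_eq)

lemma gauss_pos [simp]: "0 < gauss x" by (simp add: gauss_def)

text \<open>The transform is read off from the characteristic function of the standard normal law,
  taken at \<open>- w\<close> because that function uses the opposite sign in the phase. The
  normalisation of the density yields the eigenvalue \<open>sqrt (2 * pi)\<close>.\<close>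

lemma ft_gauss: "ft (\<lambda>x. complex_of_real (gauss x)) w = of_real (sqrt (2 * pi) * gauss w)"
proof -
  have "complex_of_real (gauss w) = (CLINT x|std_normal_distribution. iexp (- w * x))"
    using fun_cong[OF char_std_normal_distribution, of "- w"] by (simp add: char_def gauss_def)
  also have "\<dots> = (LINT x|lborel. std_normal_density x *\<^sub>R iexp (- w * x))"
    by (subst integral_density) (auto simp: normal_density_nonneg)
  finally have "of_real (sqrt (2 * pi)) * complex_of_real (gauss w) =
      (LINT x|lborel. of_real (sqrt (2 * pi)) * (std_normal_density x *\<^sub>R iexp (- w * x)))"
    by (simp only: integral_mult_right_zero)
  also have "\<dots> = ft (\<lambda>x. complex_of_real (gauss x)) w"
    unfolding ft_def by (intro Bochner_Integration.integral_cong)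
      (auto simp: gauss_eq scaleR_conv_of_real cis_conv_exp)
  finally show ?thesis by simp
qed

section \<open>Autocorrelation and the Plancherel identity\<close>

definition autocor :: "(real \<Rightarrow> complex) \<Rightarrow> real \<Rightarrow> complex" where
  "autocor f s = (LINT x|lborel. f (x + s) * cnj (f x))"

lemma integrable_translate:
  fixes f :: "real \<Rightarrow> complex"
  assumes "integrable lborel f" shows "integrable lborel (\<lambda>s. f (x + s))"
  using lborel_integrable_real_affine[OF assms, of 1 x] by simp

lemma integral_translate:
  fixes f :: "real \<Rightarrow> complex"
  shows "(LINT s|lborel. f (x + s)) = (LINT s|lborel. f s)"
  using lborel_integral_real_affine[of 1 f x] by simp

text \<open>The autocorrelation is the convolution of \<open>f\<close> with its reflected conjugate.
  Splitting the phase as \<open>w * s = w * (x + s) - w * x\<close> separates the double integral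
  into \<open>ft f w\<close> and its conjugate.\<close>

lemma autocor_L1:
  assumes f: "integrable lborel f"
  shows "integrable lborel (autocor f)" "ft (autocor f) w = of_real ((cmod (ft f w))\<^sup>2)"
proof -
  have [measurable]: "f \<in> borel_measurable borel" using f by auto
  let ?F = "\<lambda>x s. f (x + s) * cnj (f x) * cis (- (w * s))"
  have i: "integrable (lborel \<Otimes>\<^sub>M lborel) (\<lambda>(x, s). f (x + s) * cnj (f x) * cis (- (w * s)))" for w
  proof (rule lborel_pair.Fubini_integrable)
    have "(LINT s|lborel. cmod (f (x + s))) = (LINT s|lborel. cmod (f s))" for x
      using lborel_integral_real_affine[of 1 "\<lambda>s. cmod (f s)" x] by simp
    then show "integrable lborel (\<lambda>x. LINT s|lborel. norm (case (x, s) of (x, s) \<Rightarrow> f (x + s) * cnj (f x) * cis (- (w * s))))"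
      using f by (simp add: norm_mult)
    have "integrable lborel (\<lambda>s. f (x + s) * cnj (f x) * cis (- (w * s)))" for x
      using integrable_translate[OF f] by (intro integrable_mult_cis integrable_mult_left) auto
    then show "AE x in lborel. integrable lborel (\<lambda>s. case (x, s) of (x, s) \<Rightarrow> f (x + s) * cnj (f x) * cis (- (w * s)))" by simp
  qed measurable
  \<comment> \<open>At \<open>w = 0\<close> the phase is 1, and Fubini's theorem gives the
    integrability of the inner integrals.\<close>
  show "integrable lborel (autocor f)"
    using lborel_pair.integrable_snd[OF i[of 0]] by (simp add: autocor_def[abs_def])
  have "ft (autocor f) w = (LINT s|lborel. LINT x|lborel. ?F x s)"
    unfolding ft_def autocor_def by simp
  also have "\<dots> = (LINT x|lborel. LINT s|lborel. ?F x s)"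
    using lborel_pair.Fubini_integral[OF i] by simp
  also have "\<dots> = (LINT x|lborel. cnj (f x * cis (- (w * x))) * ft f w)"
  proof (rule Bochner_Integration.integral_cong[OF refl])
    fix x
    have "(LINT s|lborel. ?F x s) = (LINT s|lborel. cnj (f x * cis (- (w * x))) * (f (x + s) * cis (- (w * (x + s)))))"
    proof (rule Bochner_Integration.integral_cong[OF refl])
      fix s
      have "cis (- (w * s)) = cis (w * x) * cis (- (w * (x + s)))"
        by (simp add: cis_mult distrib_left)
      then show "?F x s = cnj (f x * cis (- (w * x))) * (f (x + s) * cis (- (w * (x + s))))"
        by (simp add: cis_cnj)
    qed
    also have "\<dots> = cnj (f x * cis (- (w * x))) * ft f w"
      using integral_translate[of "\<lambda>s. f s * cis (- (w * s))" x] by (simp add: ft_def)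
    finally show "(LINT s|lborel. ?F x s) = \<dots>" .
  qed
  also have "\<dots> = cnj (ft f w) * ft f w"
    unfolding ft_def by (simp del: complex_cnj_mult flip: integral_cnj)
  finally show "ft (autocor f) w = of_real ((cmod (ft f w))\<^sup>2)"
    by (simp add: complex_norm_square mult.commute del: of_real_power)
qed

lemma autocor_bound:
  assumes "L2_borel f" shows "cmod (autocor f s) \<le> energy f"
  using L2_Cauchy_Schwarz[OF L2_borel_translate(1)[OF assms, of s] L2_borel_cnj[OF assms]]
    L2_borel_translate(2)[OF assms, of s]
  by (simp add: autocor_def energy_def)

text \<open>
  The Fourier transform of the autocorrelation is the squared modulus of the transform. Testing
  it against the Gaussians \<open>gauss (s w)\<close> and moving the transform onto the Gaussian gives a mean of
  the autocorrelation that concentrates at \<open>0\<close> as \<open>s\<close> tends to \<open>0\<close>, where it has the value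
  \<open>energy f\<close>.
\<close>

theorem Plancherel_L1:
  assumes f: "integrable lborel f" "L2_borel f"
  shows "L2_borel (ft f)" "energy (ft f) = 2 * pi * energy f"
proof -
  have [measurable]: "f \<in> borel_measurable borel" using f by auto
  have [measurable]: "gauss \<in> borel_measurable borel" using gauss_integrable by auto
  define s where "s n = 1 / real (Suc n)" for n
  have s: "s n > 0" for n by (simp add: s_def)
  have s0: "s \<longlonglongrightarrow> 0" unfolding s_def by (rule LIMSEQ_Suc[OF lim_1_over_n])
  let ?h = "\<lambda>n w. gauss (s n * w) * (cmod (ft f w))\<^sup>2"
  note rint = autocor_L1(1)[OF f(1)]
  have [measurable]: "autocor f \<in> borel_measurable borel" using rint by auto
  have gi: "integrable lborel (\<lambda>v. complex_of_real (gauss v))"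
    using gauss_integrable by (rule integrable_of_real)
  have eq: "complex_of_real (LINT w|lborel. ?h n w) =
      of_real (sqrt (2 * pi)) * (LINT v|lborel. of_real (gauss v) * autocor f (s n * v))" for n
  proof -
    have "complex_of_real (LINT w|lborel. ?h n w) =
        (LINT w|lborel. of_real (gauss (s n * w)) * ft (autocor f) w)"
      by (simp add: autocor_L1(2)[OF f(1)] flip: integral_complex_of_real)
    \<comment> \<open>The Jacobian of the substitution \<open>v = s n * w\<close> cancels the factor
      \<open>1 / s n\<close> from \<open>ft_scale\<close>.\<close>
    also have "\<dots> = (LINT v|lborel. of_real (gauss v) * ft (\<lambda>t. autocor f (s n * t)) v)"
      using s[of n] lborel_integral_real_affine[of "s n" "\<lambda>v. of_real (gauss v) * ft (\<lambda>t. autocor f (s n * t)) v" 0] s[of n]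
      by (simp add: ft_scale[OF s] scaleR_conv_of_real)
    also have "\<dots> = (LINT v|lborel. ft (\<lambda>v. of_real (gauss v)) v * autocor f (s n * v))"
      using ft_multiplication[OF gi lborel_integrable_real_affine[OF rint, of "s n" 0]] s[of n]
      by simp
    also have "\<dots> = of_real (sqrt (2 * pi)) * (LINT v|lborel. of_real (gauss v) * autocor f (s n * v))"
      by (simp only: ft_gauss of_real_mult mult.assoc integral_mult_right_zero)
    finally show ?thesis .
  qed
  have "(\<lambda>n. LINT v|lborel. of_real (gauss v) * autocor f (s n * v)) \<longlonglongrightarrow>
      (LINT v|lborel. of_real (gauss v) * complex_of_real (energy f))"
  proof (rule integral_dominated_convergence)
    show "integrable lborel (\<lambda>v. gauss v * energy f)" using gauss_integrable by simp
    show "AE v in lborel. (\<lambda>n. of_real (gauss v) * autocor f (s n * v)) \<longlonglongrightarrow> of_real (gauss v) * complex_of_real (energy f)"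
    proof (rule AE_I2)
      fix v
      have "(\<lambda>n. s n * v) \<longlonglongrightarrow> 0" using tendsto_mult_right[OF s0, of v] by simp
      from correlation_tendsto[OF f(2) this]
      show "(\<lambda>n. of_real (gauss v) * autocor f (s n * v)) \<longlonglongrightarrow> of_real (gauss v) * complex_of_real (energy f)"
        unfolding autocor_def by (intro tendsto_mult tendsto_const)
    qed
    show "AE v in lborel. norm (of_real (gauss v) * autocor f (s n * v)) \<le> gauss v * energy f" for n
      using autocor_bound[OF f(2)] by (auto simp: norm_mult less_imp_le)
  qed measurable
  also have "(LINT v|lborel. of_real (gauss v) * complex_of_real (energy f)) = of_real (sqrt (2 * pi) * energy f)"
    by (simp only: integral_mult_left_zero integral_complex_of_real gauss_integral of_real_mult)
  finally have "(\<lambda>n. complex_of_real (LINT w|lborel. ?h n w)) \<longlonglongrightarrow>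
      of_real (sqrt (2 * pi)) * of_real (sqrt (2 * pi) * energy f)"
    unfolding eq by (intro tendsto_mult tendsto_const)
  also have "of_real (sqrt (2 * pi)) * of_real (sqrt (2 * pi) * energy f) = complex_of_real (2 * pi * energy f)"
    by (simp flip: of_real_mult mult.assoc)
  finally have lim: "(\<lambda>n. LINT w|lborel. ?h n w) \<longlonglongrightarrow> 2 * pi * energy f"
    unfolding tendsto_of_real_iff .
  have hint: "integrable lborel (?h n)" for n
  proof (rule Bochner_Integration.integrable_bound)
    show "integrable lborel (\<lambda>w. (LINT t|lborel. cmod (f t))\<^sup>2 * gauss (s n * w))"
      using lborel_integrable_real_affine[OF gauss_integrable, of "s n" 0] s[of n] by simp
    show "AE w in lborel. norm (?h n w) \<le> norm ((LINT t|lborel. cmod (f t))\<^sup>2 * gauss (s n * w))"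
      using power_mono[OF cmod_ft_le[of f] norm_ge_zero, of _ 2]
      by (auto simp: abs_mult less_imp_le mult.commute intro!: mult_left_mono)
  qed measurable
  \<comment> \<open>The weights increase to 1 as \<open>s n\<close> decreases. Monotone convergence
    thus turns the convergence of the weighted integrals into integrability of the squared modulus
    of \<open>ft f\<close>, which is not known beforehand.\<close>
  have hmono: "AE w in lborel. mono (\<lambda>n. ?h n w)"
  proof (rule AE_I2)
    fix w show "mono (\<lambda>n. ?h n w)"
    proof (rule monoI)
      fix m n :: nat assume "m \<le> n"
      then have "s n \<le> s m" by (simp add: s_def frac_le)
      then have "\<bar>s n * w\<bar> \<le> \<bar>s m * w\<bar>" using s[of n] s[of m] by (simp add: abs_mult mult_right_mono)
      then have "(s n * w)\<^sup>2 \<le> (s m * w)\<^sup>2" by (rule abs_le_square_iff[THEN iffD1])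
      then have "gauss (s m * w) \<le> gauss (s n * w)" by (simp add: gauss_def)
      then show "?h m w \<le> ?h n w" by (intro mult_right_mono) auto
    qed
  qed
  have hlim: "AE w in lborel. (\<lambda>n. ?h n w) \<longlonglongrightarrow> (cmod (ft f w))\<^sup>2"
  proof (rule AE_I2)
    fix w
    have "(\<lambda>n. exp (- (s n * w)\<^sup>2 / 2) * (cmod (ft f w))\<^sup>2) \<longlonglongrightarrow> exp (- (0 * w)\<^sup>2 / 2) * (cmod (ft f w))\<^sup>2"
      by (intro tendsto_intros s0) auto
    then show "(\<lambda>n. ?h n w) \<longlonglongrightarrow> (cmod (ft f w))\<^sup>2" by (simp add: gauss_def)
  qed
  show "L2_borel (ft f)"
    using integrable_monotone_convergence[OF hint hmono hlim lim] by (simp add: L2_borel_def)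
  show "energy (ft f) = 2 * pi * energy f"
    using integral_monotone_convergence[OF hint hmono hlim lim] by (simp add: energy_def)
qed

section \<open>The Fourier transform of a square-integrable function\<close>

text \<open>The closure, in pairs of square-integrable functions, of the graph of \<open>ft\<close>
  on functions that are both integrable and square-integrable. Arbitrary approximating sequences are
  allowed, so that dilations, reflections and linear combinations of approximants can serve as
  approximants again.\<close>

definition is_ft :: "(real \<Rightarrow> complex) \<Rightarrow> (real \<Rightarrow> complex) \<Rightarrow> bool" where
  "is_ft f F \<longleftrightarrow> L2_borel f \<and> L2_borel F \<and>
     (\<exists>k::nat \<Rightarrow> real \<Rightarrow> complex. (\<forall>n. integrable lborel (k n) \<and> L2_borel (k n)) \<and>
        (\<lambda>n. energy (\<lambda>t. k n t - f t)) \<longlonglongrightarrow> 0 \<and> (\<lambda>n. energy (\<lambda>w. ft (k n) w - F w)) \<longlonglongrightarrow> 0)"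

lemma is_ftI:
  fixes k :: "nat \<Rightarrow> real \<Rightarrow> complex"
  assumes "L2_borel f" "L2_borel F" "\<And>n. integrable lborel (k n)" "\<And>n. L2_borel (k n)"
    "(\<lambda>n. energy (\<lambda>t. k n t - f t)) \<longlonglongrightarrow> 0" "(\<lambda>n. energy (\<lambda>w. ft (k n) w - F w)) \<longlonglongrightarrow> 0"
  shows "is_ft f F"
  unfolding is_ft_def using assms by (intro conjI exI[of _ k]) auto

lemma is_ftE:
  assumes "is_ft f F"
  obtains k :: "nat \<Rightarrow> real \<Rightarrow> complex" where "\<And>n. integrable lborel (k n)" "\<And>n. L2_borel (k n)"
    "\<And>n. L2_borel (ft (k n))"
    "(\<lambda>n. energy (\<lambda>t. k n t - f t)) \<longlonglongrightarrow> 0" "(\<lambda>n. energy (\<lambda>w. ft (k n) w - F w)) \<longlonglongrightarrow> 0"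
  using assms Plancherel_L1(1) unfolding is_ft_def by blast

lemma is_ft_L2: assumes "is_ft f F" shows "L2_borel f" "L2_borel F"
  using assms by (auto simp: is_ft_def)

lemma is_ft_L1:
  assumes "integrable lborel f" "L2_borel f" shows "is_ft f (ft f)"
  using assms Plancherel_L1[OF assms] by (intro is_ftI[where k = "\<lambda>_. f"]) (auto simp: energy_def)

theorem is_ft_energy:
  assumes "is_ft f F" shows "energy F = 2 * pi * energy f"
proof -
  obtain k where k: "\<And>n. integrable lborel (k n)" "\<And>n. L2_borel (k n)" "\<And>n. L2_borel (ft (k n))"
    "(\<lambda>n. energy (\<lambda>t. k n t - f t)) \<longlonglongrightarrow> 0" "(\<lambda>n. energy (\<lambda>w. ft (k n) w - F w)) \<longlonglongrightarrow> 0"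
    by (rule is_ftE[OF assms]) (rule that)
  have "(\<lambda>n. energy (ft (k n))) \<longlonglongrightarrow> energy F"
    by (intro energy_tendsto k is_ft_L2[OF assms])
  moreover have "(\<lambda>n. 2 * pi * energy (k n)) \<longlonglongrightarrow> 2 * pi * energy f"
    by (intro tendsto_mult_left energy_tendsto k is_ft_L2[OF assms])
  ultimately show ?thesis
    unfolding Plancherel_L1(2)[OF k(1,2)] by (rule LIMSEQ_unique)
qed

lemma ft_lincomb:
  assumes "integrable lborel f" "integrable lborel g"
  shows "ft (\<lambda>t. f t + c * g t) w = ft f w + c * ft g w"
  using integrable_mult_cis[OF assms(1)] integrable_mult_cis[OF assms(2)]
  by (simp add: ft_def distrib_right mult.assoc)

lemma is_ft_lincomb:
  assumes f: "is_ft f F" and g: "is_ft g G"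
  shows "is_ft (\<lambda>t. f t + c * g t) (\<lambda>w. F w + c * G w)"
proof -
  obtain k where k: "\<And>n. integrable lborel (k n)" "\<And>n. L2_borel (k n)" "\<And>n. L2_borel (ft (k n))"
    "(\<lambda>n. energy (\<lambda>t. k n t - f t)) \<longlonglongrightarrow> 0" "(\<lambda>n. energy (\<lambda>w. ft (k n) w - F w)) \<longlonglongrightarrow> 0"
    by (rule is_ftE[OF f]) (rule that)
  obtain l where l: "\<And>n. integrable lborel (l n)" "\<And>n. L2_borel (l n)" "\<And>n. L2_borel (ft (l n))"
    "(\<lambda>n. energy (\<lambda>t. l n t - g t)) \<longlonglongrightarrow> 0" "(\<lambda>n. energy (\<lambda>w. ft (l n) w - G w)) \<longlonglongrightarrow> 0"
    by (rule is_ftE[OF g]) (rule that)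
  note L2 = is_ft_L2[OF f] is_ft_L2[OF g]
  have comb: "(\<lambda>n. energy (\<lambda>t. (u n t + c * v n t) - (u' t + c * v' t))) \<longlonglongrightarrow> 0"
    if "\<And>n. L2_borel (u n)" "\<And>n. L2_borel (v n)" "L2_borel u'" "L2_borel v'"
      "(\<lambda>n. energy (\<lambda>t. u n t - u' t)) \<longlonglongrightarrow> 0" "(\<lambda>n. energy (\<lambda>t. v n t - v' t)) \<longlonglongrightarrow> 0"
    for u v :: "nat \<Rightarrow> real \<Rightarrow> complex" and u' v'
  proof (rule energy_null_comparison)
    have "(\<lambda>n. 2 * energy (\<lambda>t. u n t - u' t) + 2 * ((cmod c)\<^sup>2 * energy (\<lambda>t. v n t - v' t)))
        \<longlonglongrightarrow> 2 * 0 + 2 * ((cmod c)\<^sup>2 * 0)"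
      by (intro tendsto_intros that)
    then show "(\<lambda>n. 2 * energy (\<lambda>t. u n t - u' t) + 2 * ((cmod c)\<^sup>2 * energy (\<lambda>t. v n t - v' t))) \<longlonglongrightarrow> 0"
      by simp
    fix n
    have "energy (\<lambda>t. (u n t - u' t) + c * (v n t - v' t))
        \<le> 2 * energy (\<lambda>t. u n t - u' t) + 2 * ((cmod c)\<^sup>2 * energy (\<lambda>t. v n t - v' t))"
      unfolding energy_cmult[symmetric]
      by (intro energy_add_le L2_borel_cmult L2_borel_diff that)
    then show "energy (\<lambda>t. (u n t + c * v n t) - (u' t + c * v' t))
        \<le> 2 * energy (\<lambda>t. u n t - u' t) + 2 * ((cmod c)\<^sup>2 * energy (\<lambda>t. v n t - v' t))"
      by (simp add: algebra_simps)
  qed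
  show ?thesis
  proof (rule is_ftI[where k = "\<lambda>n t. k n t + c * l n t"])
    show "(\<lambda>n. energy (\<lambda>t. k n t + c * l n t - (f t + c * g t))) \<longlonglongrightarrow> 0"
      by (intro comb k l L2)
    show "(\<lambda>n. energy (\<lambda>w. ft (\<lambda>t. k n t + c * l n t) w - (F w + c * G w))) \<longlonglongrightarrow> 0"
      unfolding ft_lincomb[OF k(1) l(1)] by (intro comb k l L2)
  qed (use k l in \<open>auto intro!: L2_borel_add L2_borel_cmult L2\<close>)
qed

lemma is_ft_diff:
  assumes "is_ft f F" "is_ft g G" shows "is_ft (\<lambda>t. f t - g t) (\<lambda>w. F w - G w)"
  using is_ft_lincomb[OF assms, of "-1"] by simp

text \<open>Polarisation. Both sides of \<open>is_ft_energy\<close> for \<open>f + c * g\<close> are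
  expanded; \<open>c = 1\<close> yields the real part of the inner product and
  \<open>c = \<i>\<close> the imaginary part.\<close>

theorem is_ft_Parseval:
  assumes f: "is_ft f F" and g: "is_ft g G"
  shows "(LINT w|lborel. F w * cnj (G w)) = of_real (2 * pi) * (LINT t|lborel. f t * cnj (g t))"
proof -
  note L2 = is_ft_L2[OF f] is_ft_L2[OF g]
  have ex: "2 * Re (cnj c * (LINT x|lborel. u x * cnj (v x))) =
      energy (\<lambda>x. u x + c * v x) - energy u - (cmod c)\<^sup>2 * energy v"
    if "L2_borel u" "L2_borel v" for u v c
  proof -
    have "(LINT x|lborel. u x * cnj (c * v x)) = cnj c * (LINT x|lborel. u x * cnj (v x))"
      by (simp add: mult.left_commute)
    then show ?thesis
      using energy_add[OF that(1) L2_borel_cmult[OF that(2)], of c] by (simp add: energy_cmult)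
  qed
  have "Re (cnj c * (LINT w|lborel. F w * cnj (G w))) =
      2 * pi * Re (cnj c * (LINT t|lborel. f t * cnj (g t)))" for c
  proof -
    have "2 * Re (cnj c * (LINT w|lborel. F w * cnj (G w))) =
        2 * pi * energy (\<lambda>t. f t + c * g t) - 2 * pi * energy f - (cmod c)\<^sup>2 * (2 * pi * energy g)"
      using ex[OF L2(2) L2(4), of c] is_ft_energy[OF is_ft_lincomb[OF f g], of c]
        is_ft_energy[OF f] is_ft_energy[OF g] by simp
    also have "\<dots> = 2 * pi * (energy (\<lambda>t. f t + c * g t) - energy f - (cmod c)\<^sup>2 * energy g)"
      by (simp add: algebra_simps)
    finally show ?thesis
      unfolding ex[OF L2(1) L2(3), symmetric] by linarith
  qed
  from this[of 1] this[of \<i>] show ?thesis by (simp add: complex_eq_iff)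
qed

text \<open>Both sides are continuous with respect to \<open>energy\<close> in the pair
  \<open>g\<close>, \<open>G\<close>, so the identity passes from the integrable approximants of
  \<open>g\<close> to \<open>g\<close> itself.\<close>

lemma is_ft_multiplication:
  assumes K: "integrable lborel K" "L2_borel K" and g: "is_ft g G"
  shows "(LINT w|lborel. ft K w * g w) = (LINT t|lborel. K t * G t)"
proof -
  obtain k where k: "\<And>n. integrable lborel (k n)" "\<And>n. L2_borel (k n)" "\<And>n. L2_borel (ft (k n))"
    "(\<lambda>n. energy (\<lambda>t. k n t - g t)) \<longlonglongrightarrow> 0" "(\<lambda>n. energy (\<lambda>w. ft (k n) w - G w)) \<longlonglongrightarrow> 0"
    by (rule is_ftE[OF g]) (rule that)
  have "(\<lambda>n. LINT w|lborel. k n w * ft K w) \<longlonglongrightarrow> (LINT w|lborel. g w * ft K w)"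
    by (intro L2_inner_tendsto k is_ft_L2[OF g] Plancherel_L1 K)
  moreover have "(\<lambda>n. LINT t|lborel. ft (k n) t * K t) \<longlonglongrightarrow> (LINT t|lborel. G t * K t)"
    by (intro L2_inner_tendsto k is_ft_L2[OF g] K)
  ultimately have "(LINT w|lborel. g w * ft K w) = (LINT t|lborel. G t * K t)"
    unfolding ft_multiplication[OF k(1) K(1)] by (rule LIMSEQ_unique)
  then show ?thesis by (simp add: mult.commute)
qed

lemma ft_cnj_reflect: "ft (\<lambda>t. cnj (f (- t))) w = cnj (ft f w)"
proof -
  have "cnj (ft f w) = (LINT t|lborel. cnj (f t * cis (- (w * t))))"
    by (simp add: ft_def del: complex_cnj_mult flip: integral_cnj)
  then show ?thesis
    using lborel_integral_real_affine[of "-1" "\<lambda>t. cnj (f (- t)) * cis (- (w * t))" 0]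
    by (simp add: ft_def cis_cnj)
qed

lemma L2_borel_cnj_reflect:
  assumes "L2_borel f"
  shows "L2_borel (\<lambda>t. cnj (f (- t)))" "energy (\<lambda>t. cnj (f (- t))) = energy f"
  using L2_borel_cnj[OF L2_borel_affine(1)[OF assms, of "-1" 0]] L2_borel_affine(2)[OF assms, of "-1" 0]
  by (simp_all add: energy_def)

text \<open>Turns the multiplication formula, which has no conjugates, into the inner product needed
  in \<open>energy_inversion\<close>.\<close>

lemma is_ft_cnj_reflect:
  assumes f: "is_ft f F"
  shows "is_ft (\<lambda>t. cnj (f (- t))) (\<lambda>w. cnj (F w))"
proof -
  obtain k where k: "\<And>n. integrable lborel (k n)" "\<And>n. L2_borel (k n)" "\<And>n. L2_borel (ft (k n))"
    "(\<lambda>n. energy (\<lambda>t. k n t - f t)) \<longlonglongrightarrow> 0" "(\<lambda>n. energy (\<lambda>w. ft (k n) w - F w)) \<longlonglongrightarrow> 0"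
    by (rule is_ftE[OF f]) (rule that)
  note L2 = is_ft_L2[OF f]
  show ?thesis
  proof (rule is_ftI[where k = "\<lambda>n t. cnj (k n (- t))"])
    show "integrable lborel (\<lambda>t. cnj (k n (- t)))" for n
      using lborel_integrable_real_affine[OF k(1)[of n], of "-1" 0] by (intro integrable_cnj) simp
    show "(\<lambda>n. energy (\<lambda>t. cnj (k n (- t)) - cnj (f (- t)))) \<longlonglongrightarrow> 0"
      using L2_borel_cnj_reflect(2)[OF L2_borel_diff[OF k(2) L2(1)]] k(4) by simp
    show "(\<lambda>n. energy (\<lambda>w. ft (\<lambda>t. cnj (k n (- t))) w - cnj (F w))) \<longlonglongrightarrow> 0"
      using k(5) by (simp add: ft_cnj_reflect energy_def flip: complex_cnj_diff)
  qed (rule L2_borel_cnj_reflect L2_borel_cnj L2 k)+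
qed

lemma ft_affine:
  assumes "a \<noteq> 0"
  shows "ft (\<lambda>t. f ((t - b) / a)) w = of_real \<bar>a\<bar> * cis (- (b * w)) * ft f (a * w)"
proof -
  have "ft (\<lambda>t. f ((t - b) / a)) w = \<bar>a\<bar> *\<^sub>R (LINT u|lborel. f u * cis (- (w * (b + a * u))))"
    using lborel_integral_real_affine[OF assms, of "\<lambda>t. f ((t - b) / a) * cis (- (w * t))" b] assms
    by (simp add: ft_def)
  also have "(LINT u|lborel. f u * cis (- (w * (b + a * u)))) =
      (LINT u|lborel. cis (- (b * w)) * (f u * cis (- (a * w * u))))"
  proof (rule Bochner_Integration.integral_cong[OF refl])
    fix u
    have "cis (- (w * (b + a * u))) = cis (- (b * w)) * cis (- (a * w * u))"
      by (simp add: cis_mult algebra_simps)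
    then show "f u * cis (- (w * (b + a * u))) = cis (- (b * w)) * (f u * cis (- (a * w * u)))" by simp
  qed
  finally show ?thesis by (simp add: ft_def scaleR_conv_of_real)
qed

lemma affine_inverse: "(t - b) / a = - b / a + 1 / a * t" for a b t :: real
  by (simp add: diff_divide_distrib)

lemma L2_borel_affine':
  assumes "L2_borel f" "a \<noteq> 0"
  shows "L2_borel (\<lambda>t. f ((t - b) / a))" "energy (\<lambda>t. f ((t - b) / a)) = \<bar>a\<bar> * energy f"
  using L2_borel_affine[OF assms(1), of "1 / a" "- b / a"] assms(2)
  unfolding affine_inverse by simp_all

lemma is_ft_affine:
  assumes f: "is_ft f F" and a: "a \<noteq> 0"
  shows "is_ft (\<lambda>t. f ((t - b) / a)) (\<lambda>w. of_real \<bar>a\<bar> * cis (- (b * w)) * F (a * w))"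
proof -
  obtain k where k: "\<And>n. integrable lborel (k n)" "\<And>n. L2_borel (k n)" "\<And>n. L2_borel (ft (k n))"
    "(\<lambda>n. energy (\<lambda>t. k n t - f t)) \<longlonglongrightarrow> 0" "(\<lambda>n. energy (\<lambda>w. ft (k n) w - F w)) \<longlonglongrightarrow> 0"
    by (rule is_ftE[OF f]) (rule that)
  note L2 = is_ft_L2[OF f]
  have L2F: "L2_borel (\<lambda>w. of_real \<bar>a\<bar> * cis (- (b * w)) * G (a * w))"
    "energy (\<lambda>w. of_real \<bar>a\<bar> * cis (- (b * w)) * G (a * w)) = \<bar>a\<bar> * energy G" if "L2_borel G" for G
  proof -
    have [measurable]: "G \<in> borel_measurable borel" using that by measurable
    note 1 = L2_borel_affine[OF that a, of 0, simplified]
    have eq: "(cmod (of_real \<bar>a\<bar> * cis (- (b * w)) * G (a * w)))\<^sup>2 = \<bar>a\<bar>\<^sup>2 * (cmod (G (a * w)))\<^sup>2" for w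
      by (simp add: norm_mult power_mult_distrib)
    show "L2_borel (\<lambda>w. of_real \<bar>a\<bar> * cis (- (b * w)) * G (a * w))"
      using L2_borel_integrable[OF 1(1)] unfolding L2_borel_def eq by simp
    show "energy (\<lambda>w. of_real \<bar>a\<bar> * cis (- (b * w)) * G (a * w)) = \<bar>a\<bar> * energy G"
    proof -
      have "energy (\<lambda>w. of_real \<bar>a\<bar> * cis (- (b * w)) * G (a * w)) = \<bar>a\<bar>\<^sup>2 * energy (\<lambda>w. G (a * w))"
        unfolding energy_def eq by (rule integral_mult_right_zero)
      also have "\<dots> = \<bar>a\<bar> * (\<bar>a\<bar> * (energy G / \<bar>a\<bar>))"
        unfolding 1(2) by (simp only: power2_eq_square mult.assoc)
      finally show ?thesis using a by simp
    qed
  qed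
  show ?thesis
  proof (rule is_ftI[where k = "\<lambda>n t. k n ((t - b) / a)"])
    show "integrable lborel (\<lambda>t. k n ((t - b) / a))" for n
      using lborel_integrable_real_affine[OF k(1)[of n], of "1 / a" "- b / a"] a
      unfolding affine_inverse by simp
    show "(\<lambda>n. energy (\<lambda>t. k n ((t - b) / a) - f ((t - b) / a))) \<longlonglongrightarrow> 0"
      using tendsto_mult_right_zero[OF k(4), of "\<bar>a\<bar>"]
      by (simp add: L2_borel_affine'(2)[OF L2_borel_diff[OF k(2) L2(1)] a])
    show "(\<lambda>n. energy (\<lambda>w. ft (\<lambda>t. k n ((t - b) / a)) w - of_real \<bar>a\<bar> * cis (- (b * w)) * F (a * w))) \<longlonglongrightarrow> 0"
      using tendsto_mult_right_zero[OF k(5), of "\<bar>a\<bar>"]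
      by (simp only: ft_affine[OF a] L2F(2)[OF L2_borel_diff[OF k(3) L2(2)]] flip: right_diff_distrib)
  qed (rule L2_borel_affine'(1)[OF L2(1) a] L2_borel_affine'(1)[OF k(2) a] L2F(1)[OF L2(2)])+
qed

section \<open>Completeness and existence of the transform\<close>

lemma nn_integral_energy:
  assumes "L2_borel f" shows "(\<integral>\<^sup>+x. ennreal ((cmod (f x))\<^sup>2) \<partial>lborel) = ennreal (energy f)"
  unfolding energy_def by (rule nn_integral_eq_integral) (auto intro: L2_borel_integrable assms)

lemma L2_borel_nn_integral_le:
  assumes "f \<in> borel_measurable borel" "(\<integral>\<^sup>+x. ennreal ((cmod (f x))\<^sup>2) \<partial>lborel) \<le> ennreal e" "0 \<le> e"
  shows "L2_borel f" "energy f \<le> e"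
proof -
  show L2: "L2_borel f"
    unfolding L2_borel_def using assms
    by (intro conjI integrableI_nonneg) (auto intro: le_less_trans)
  show "energy f \<le> e"
    using assms(2,3) by (simp add: nn_integral_energy[OF L2])
qed

text \<open>
  The weights \<open>2 ^ k\<close> are small enough for \<open>2 ^ k * energy (g (Suc k) - g k)\<close> to be summable and
  large enough for the summability of \<open>2 ^ k * (cmod (g (Suc k) x - g k x))\<^sup>2\<close> to imply that of the
  increments themselves.
\<close>

lemma L2_fast_Cauchy_AE_convergent:
  fixes g :: "nat \<Rightarrow> real \<Rightarrow> complex"
  assumes g: "\<And>k. L2_borel (g k)"
    and fast: "\<And>k. energy (\<lambda>x. g (Suc k) x - g k x) \<le> (1 / 4) ^ k"
  shows "AE x in lborel. convergent (\<lambda>k. g k x)"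
proof -
  define d where "d k x = g (Suc k) x - g k x" for k x
  have d: "L2_borel (d k)" for k unfolding d_def by (intro L2_borel_diff g)
  have [measurable]: "d k \<in> borel_measurable borel" for k using d by measurable
  have "(\<integral>\<^sup>+x. (\<Sum>k. ennreal (2 ^ k * (cmod (d k x))\<^sup>2)) \<partial>lborel)
      = (\<Sum>k. \<integral>\<^sup>+x. ennreal (2 ^ k) * ennreal ((cmod (d k x))\<^sup>2) \<partial>lborel)"
    by (subst nn_integral_suminf) (auto simp: ennreal_mult)
  also have "\<dots> = (\<Sum>k. ennreal (2 ^ k * energy (d k)))"
    by (subst nn_integral_cmult) (auto simp: nn_integral_energy[OF d] ennreal_mult)
  also have "\<dots> \<le> (\<Sum>k. ennreal ((1 / 2) ^ k))"
  proof (intro suminf_le ennreal_leI)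
    fix k
    have "2 ^ k * energy (d k) \<le> 2 ^ k * (1 / 4) ^ k"
      using fast[of k] unfolding d_def by (intro mult_left_mono) auto
    then show "2 ^ k * energy (d k) \<le> (1 / 2) ^ k"
      by (simp flip: power_mult_distrib)
  qed auto
  also have "\<dots> = ennreal (\<Sum>k. (1 / 2) ^ k)"
    by (intro suminf_ennreal2 summable_geometric) auto
  also have "\<dots> < \<infinity>" by simp
  finally have "AE x in lborel. (\<Sum>k. ennreal (2 ^ k * (cmod (d k x))\<^sup>2)) \<noteq> \<infinity>"
    by (intro nn_integral_PInf_AE) auto
  then show ?thesis
  proof eventually_elim
    case (elim x)
    have "summable (\<lambda>k. 2 ^ k * (cmod (d k x))\<^sup>2)"
      using elim by (intro summable_suminf_not_top) auto
    then have "summable (\<lambda>k. 2 ^ k * (cmod (d k x))\<^sup>2 + (1 / 2) ^ k)"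
      by (intro summable_add summable_geometric) auto
    then have "summable (\<lambda>k. d k x)"
    proof (rule summable_comparison_test')
      fix k
      have "y \<le> y\<^sup>2 + 1" for y :: real
      proof -
        have "2 * y \<le> y\<^sup>2 + 1" using sum_squares_bound[of y 1] by simp
        then show ?thesis using zero_le_power2[of y] by linarith
      qed
      from this[of "2 ^ k * cmod (d k x)"]
      have "cmod (d k x) \<le> ((2 ^ k * cmod (d k x))\<^sup>2 + 1) / 2 ^ k"
        by (simp add: field_simps)
      also have "\<dots> = 2 ^ k * (cmod (d k x))\<^sup>2 + (1 / 2) ^ k"
        by (simp add: field_simps power2_eq_square)
      finally show "norm (d k x) \<le> 2 ^ k * (cmod (d k x))\<^sup>2 + (1 / 2) ^ k" .
    qed
    then have "(\<lambda>n. \<Sum>k<n. d k x) \<longlonglongrightarrow> (\<Sum>k. d k x)"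
      by (simp add: summable_LIMSEQ)
    then have "(\<lambda>n. g n x - g 0 x) \<longlonglongrightarrow> (\<Sum>k. d k x)"
      unfolding d_def sum_lessThan_telescope[of "\<lambda>k. g k x"] .
    from tendsto_add[OF this tendsto_const[of "g 0 x"]] show ?case by (auto simp: convergent_def)
  qed
qed

text \<open>Riesz-Fischer: a rapidly converging subsequence supplies the limit almost everywhere,
  and Fatou's lemma carries the Cauchy bounds for \<open>f n - f m\<close> over to
  \<open>f n - F\<close>.\<close>

theorem L2_complete:
  fixes f :: "nat \<Rightarrow> real \<Rightarrow> complex"
  assumes f: "\<And>n. L2_borel (f n)"
    and Cauchy: "\<And>e. e > 0 \<Longrightarrow> \<exists>N. \<forall>m\<ge>N. \<forall>n\<ge>N. energy (\<lambda>x. f m x - f n x) \<le> e"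
  obtains F where "L2_borel F" "(\<lambda>n. energy (\<lambda>x. f n x - F x)) \<longlonglongrightarrow> 0"
proof -
  have [measurable]: "f k \<in> borel_measurable borel" for k using f by measurable
  obtain N where N: "\<And>k m n. m \<ge> N k \<Longrightarrow> n \<ge> N k \<Longrightarrow> energy (\<lambda>x. f m x - f n x) \<le> (1 / 4) ^ k"
    using Cauchy[of "(1 / 4) ^ _"] by (metis zero_less_power zero_less_divide_1_iff zero_less_numeral)
  \<comment> \<open>The partial sums make \<open>r\<close> monotone and at least \<open>N k\<close>;
    the summand \<open>k\<close> makes it unbounded.\<close>
  define r where "r k = k + (\<Sum>i\<le>k. N i)" for k
  have rN: "r k \<ge> N k" for k
    unfolding r_def by (simp add: trans_le_add2 member_le_sum)
  have rk: "r k \<ge> k" for k by (simp add: r_def)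
  have rmono: "r k \<le> r (Suc k)" for k by (simp add: r_def)
  have conv: "AE x in lborel. convergent (\<lambda>k. f (r k) x)"
  proof (rule L2_fast_Cauchy_AE_convergent[OF f])
    show "energy (\<lambda>x. f (r (Suc k)) x - f (r k) x) \<le> (1 / 4) ^ k" for k
      using rN[of k] rmono[of k] by (intro N) linarith+
  qed
  \<comment> \<open>On the null set where the subsequence diverges, \<open>lim\<close> returns an
    unspecified value, which no integral sees.\<close>
  define F where "F x = lim (\<lambda>k. f (r k) x)" for x
  have [measurable]: "F \<in> borel_measurable borel" unfolding F_def[abs_def] by measurable
  have bound: "(\<integral>\<^sup>+x. ennreal ((cmod (f n x - F x))\<^sup>2) \<partial>lborel) \<le> ennreal e"
    if n: "\<And>m. m \<ge> M \<Longrightarrow> energy (\<lambda>x. f n x - f m x) \<le> e" for n M e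
  proof -
    have "(\<integral>\<^sup>+x. ennreal ((cmod (f n x - F x))\<^sup>2) \<partial>lborel)
        = (\<integral>\<^sup>+x. liminf (\<lambda>k. ennreal ((cmod (f n x - f (r k) x))\<^sup>2)) \<partial>lborel)"
    proof (rule nn_integral_cong_AE)
      show "AE x in lborel. ennreal ((cmod (f n x - F x))\<^sup>2) = liminf (\<lambda>k. ennreal ((cmod (f n x - f (r k) x))\<^sup>2))"
        using conv
      proof eventually_elim
        case (elim x)
        then have "(\<lambda>k. f (r k) x) \<longlonglongrightarrow> F x" by (simp add: F_def convergent_LIMSEQ_iff)
        then have "(\<lambda>k. ennreal ((cmod (f n x - f (r k) x))\<^sup>2)) \<longlonglongrightarrow> ennreal ((cmod (f n x - F x))\<^sup>2)"
          by (intro tendsto_ennrealI tendsto_intros)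
        then show ?case by (intro lim_imp_Liminf[symmetric]) simp_all
      qed
    qed
    also have "\<dots> \<le> liminf (\<lambda>k. \<integral>\<^sup>+x. ennreal ((cmod (f n x - f (r k) x))\<^sup>2) \<partial>lborel)"
      by (rule nn_integral_liminf) measurable
    also have "\<dots> = liminf (\<lambda>k. ennreal (energy (\<lambda>x. f n x - f (r k) x)))"
      by (simp only: nn_integral_energy[OF L2_borel_diff[OF f f]])
    also have "\<dots> \<le> ennreal e"
    proof (rule Liminf_le)
      have "energy (\<lambda>x. f n x - f (r k) x) \<le> e" if "k \<ge> M" for k
        using that rk[of k] by (intro n) linarith
      then show "\<forall>\<^sub>F k in sequentially. ennreal (energy (\<lambda>x. f n x - f (r k) x)) \<le> ennreal e"
        by (auto simp: eventually_sequentially intro!: exI[of _ M] ennreal_leI)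
    qed simp
    finally show ?thesis .
  qed
  have lim: "\<exists>M. \<forall>n\<ge>M. L2_borel (\<lambda>x. f n x - F x) \<and> energy (\<lambda>x. f n x - F x) \<le> e" if e: "e > 0" for e
  proof -
    obtain M where M: "\<forall>m\<ge>M. \<forall>n\<ge>M. energy (\<lambda>x. f m x - f n x) \<le> e" using Cauchy[OF e] by blast
    have "L2_borel (\<lambda>x. f n x - F x) \<and> energy (\<lambda>x. f n x - F x) \<le> e" if "n \<ge> M" for n
      using L2_borel_nn_integral_le[OF _ bound[of M n e]] M that e by simp
    then show ?thesis by blast
  qed
  show thesis
  proof
    obtain n where "L2_borel (\<lambda>x. f n x - F x)" using lim[of 1] by auto
    from L2_borel_diff[OF f[of n] this] show "L2_borel F" by simp
    show "(\<lambda>n. energy (\<lambda>x. f n x - F x)) \<longlonglongrightarrow> 0"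
    proof (rule LIMSEQ_I)
      fix e :: real assume "e > 0"
      then obtain M where "\<forall>n\<ge>M. energy (\<lambda>x. f n x - F x) \<le> e / 2" using lim[of "e / 2"] by auto
      with \<open>e > 0\<close> show "\<exists>M. \<forall>n\<ge>M. norm (energy (\<lambda>x. f n x - F x) - 0) < e"
        by (intro exI[of _ M]) fastforce
    qed
  qed
qed

section \<open>Truncated functions, whose transforms are the approximants in
  \<open>fourier_L2\<close>\<close>

definition trunc :: "real \<Rightarrow> (real \<Rightarrow> complex) \<Rightarrow> real \<Rightarrow> complex" where
  "trunc r f t = f t * indicator {-r..r} t"

text \<open>The indicator of a bounded interval is square-integrable, so the truncation is a product
  of two square-integrable functions and hence integrable.\<close>

lemma trunc_L2:
  assumes f: "L2_borel f"
  shows "L2_borel (trunc r f)" "integrable lborel (trunc r f)"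
proof -
  have [measurable]: "f \<in> borel_measurable borel" using f by measurable
  have m: "trunc r f \<in> borel_measurable borel" unfolding trunc_def[abs_def] by measurable
  show "L2_borel (trunc r f)"
    using m L2_borel_integrable[OF f] by (rule L2_borel_bound) (auto simp: trunc_def indicator_def)
  have "L2_borel (\<lambda>t. complex_of_real (1 * indicator {-r..r} t))"
    using integrable_square_indicator_interval[of 1 "-r" r]
    unfolding L2_borel_def norm_of_real power2_abs by simp
  from L2_borel_mult_integrable[OF f this] show "integrable lborel (trunc r f)"
    by (simp add: trunc_def[abs_def] of_real_indicator)
qed

lemma trunc_tendsto:
  assumes f: "L2_borel f"
  shows "((\<lambda>r. energy (\<lambda>t. trunc r f t - f t)) \<longlongrightarrow> 0) at_top"
proof (rule tendsto_at_topI_sequentially)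
  fix X :: "nat \<Rightarrow> real" assume X: "filterlim X at_top sequentially"
  show "(\<lambda>n. energy (\<lambda>t. trunc (X n) f t - f t)) \<longlonglongrightarrow> 0"
  proof (rule energy_dominated_convergence[where w = "\<lambda>t. cmod (f t)"])
    show "AE t in lborel. (\<lambda>n. trunc (X n) f t) \<longlonglongrightarrow> f t"
    proof (intro AE_I2 tendsto_eventually)
      fix t
      have "\<forall>\<^sub>F n in sequentially. \<bar>t\<bar> \<le> X n"
        using X by (simp add: filterlim_at_top)
      then show "\<forall>\<^sub>F n in sequentially. trunc (X n) f t = f t"
        by eventually_elim (auto simp: trunc_def indicator_def abs_le_iff)
    qed
  qed (use f trunc_L2 in \<open>auto simp: trunc_def indicator_def L2_borel_def\<close>)
qed

lemma ft_trunc_tendsto: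
  assumes "is_ft f F"
  shows "((\<lambda>r. energy (\<lambda>w. ft (trunc r f) w - F w)) \<longlongrightarrow> 0) at_top"
proof -
  note f = is_ft_L2(1)[OF assms]
  have "energy (\<lambda>w. ft (trunc r f) w - F w) = 2 * pi * energy (\<lambda>t. trunc r f t - f t)" for r
    by (intro is_ft_energy is_ft_diff is_ft_L1 trunc_L2 f assms)
  then show ?thesis using tendsto_mult_right_zero[OF trunc_tendsto[OF f]] by simp
qed

lemma trunc_nat_tendsto:
  assumes "L2_borel f"
  shows "(\<lambda>n. energy (\<lambda>t. trunc (real n) f t - f t)) \<longlonglongrightarrow> 0"
  by (rule filterlim_compose[OF trunc_tendsto[OF assms] filterlim_real_sequentially])

theorem is_ft_exists:
  assumes f: "L2_borel f" shows "\<exists>F. is_ft f F"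
proof -
  let ?k = "\<lambda>n. trunc (real n) f"
  note k = trunc_L2[OF f]
  \<comment> \<open>The threshold \<open>e / (8 * pi)\<close> absorbs a factor \<open>2 * pi\<close>
    from Plancherel and a factor 4 from \<open>energy_triangle\<close>.\<close>
  have Cauchy: "\<exists>N. \<forall>m\<ge>N. \<forall>n\<ge>N. energy (\<lambda>w. ft (?k m) w - ft (?k n) w) \<le> e" if "e > 0" for e
  proof -
    have "\<forall>\<^sub>F n in sequentially. energy (\<lambda>t. ?k n t - f t) < e / (8 * pi)"
      using that by (intro order_tendstoD(2)[OF trunc_nat_tendsto[OF f]]) simp
    then obtain N where N: "\<And>n. n \<ge> N \<Longrightarrow> energy (\<lambda>t. ?k n t - f t) < e / (8 * pi)"
      by (auto simp: eventually_sequentially)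
    have eight: "e / (2 * pi) = 4 * (e / (8 * pi))" by simp
    have "energy (\<lambda>w. ft (?k m) w - ft (?k n) w) \<le> e" if "m \<ge> N" "n \<ge> N" for m n
    proof -
      have "energy (\<lambda>w. ft (?k m) w - ft (?k n) w) = 2 * pi * energy (\<lambda>t. ?k m t - ?k n t)"
        by (intro is_ft_energy is_ft_diff is_ft_L1 k)
      also have "energy (\<lambda>t. ?k m t - ?k n t) \<le> e / (2 * pi)"
        using energy_triangle[OF k(1) f k(1), of m n] N[OF that(1)] N[OF that(2)]
          energy_diff_commute[of "?k n" f] unfolding eight by linarith
      finally show ?thesis by (simp add: field_simps)
    qed
    then show ?thesis by blast
  qed
  obtain F where "L2_borel F" "(\<lambda>n. energy (\<lambda>w. ft (?k n) w - F w)) \<longlonglongrightarrow> 0"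
    using L2_complete[of "\<lambda>n. ft (?k n)", OF Plancherel_L1(1)[OF k(2) k(1)] Cauchy] by blast
  with k trunc_nat_tendsto[OF f] f have "is_ft f F" by (intro is_ftI[where k = ?k]) auto
  then show ?thesis by blast
qed

section \<open>Calderon's reproducing formula\<close>

lemma energy_diff:
  assumes "L2_borel f" "L2_borel g"
  shows "energy (\<lambda>x. f x - g x) = energy f - 2 * Re (LINT x|lborel. f x * cnj (g x)) + energy g"
  using energy_add[OF assms(1) L2_borel_cmult[OF assms(2), of "-1"]] by simp

text \<open>Fourier inversion in mean square. The two energies come from Plancherel; the cross term
  is moved to the frequency side by the multiplication formula, applied to the reflected conjugate
  of \<open>g\<close>. \<open>K\<close> stands for an approximation of \<open>G\<close> whose
  inverse transform is an honest integral.\<close>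

lemma energy_inversion:
  assumes K: "integrable lborel K" "L2_borel K" and g: "is_ft g G"
  shows "energy (\<lambda>t. ft K (- t) / of_real (2 * pi) - g t) = energy (\<lambda>w. K w - G w) / (2 * pi)"
proof -
  note L2 = is_ft_L2[OF g]
  have ftK: "L2_borel (\<lambda>t. ft K (- t))" "energy (\<lambda>t. ft K (- t)) = 2 * pi * energy K"
    using L2_borel_affine[OF Plancherel_L1(1)[OF K], of "-1" 0] Plancherel_L1(2)[OF K] by simp_all
  define u where "u t = of_real (1 / (2 * pi)) * ft K (- t)" for t
  have u: "L2_borel u" unfolding u_def[abs_def] by (intro L2_borel_cmult ftK)
  have eu: "energy u = energy K / (2 * pi)"
    unfolding u_def[abs_def] energy_cmult ftK(2) by (simp add: power2_eq_square norm_divide norm_mult)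
  have "(LINT t|lborel. u t * cnj (g t)) = of_real (1 / (2 * pi)) * (LINT t|lborel. ft K (- t) * cnj (g t))"
    unfolding u_def mult.assoc by (rule integral_mult_right_zero)
  also have "(LINT t|lborel. ft K (- t) * cnj (g t)) = (LINT t|lborel. ft K t * cnj (g (- t)))"
    using lborel_integral_real_affine[of "-1" "\<lambda>t. ft K (- t) * cnj (g t)" 0] by simp
  also have "\<dots> = (LINT w|lborel. K w * cnj (G w))"
    by (rule is_ft_multiplication[OF K is_ft_cnj_reflect[OF g]])
  finally have inner: "Re (LINT t|lborel. u t * cnj (g t)) = Re (LINT w|lborel. K w * cnj (G w)) / (2 * pi)"
    by (simp add: Re_divide_of_real)
  have "energy (\<lambda>t. ft K (- t) / of_real (2 * pi) - g t) = energy (\<lambda>t. u t - g t)"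
    by (simp add: u_def)
  also have "\<dots> = energy (\<lambda>w. K w - G w) / (2 * pi)"
    unfolding energy_diff[OF u L2(1)] energy_diff[OF K(2) L2(2)] eu inner is_ft_energy[OF g]
    by (simp add: field_simps)
  finally show ?thesis .
qed

lemma integrable_inverse_1_plus_square': "integrable lborel (\<lambda>x::real. 1 / (1 + x\<^sup>2))"
  using integrable_inverse_1_plus_square(1)
  by (simp add: set_integrable_def einterval_def inverse_eq_divide)

lemma AE_nonzero: "AE w in lborel. w \<noteq> (0::real)"
  by (rule AE_lborel_singleton)

lemma L2_borel_AE_bound:
  assumes "f \<in> borel_measurable borel" "integrable lborel u" "AE x in lborel. (cmod (f x))\<^sup>2 \<le> u x"
  shows "L2_borel f"
  unfolding L2_borel_def
proof
  show "integrable lborel (\<lambda>x. (cmod (f x))\<^sup>2)"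
    using assms(1,3) by (intro Bochner_Integration.integrable_bound[OF assms(2)]) auto
qed fact

locale calderon =
  fixes g G \<phi> \<Phi> :: "real \<Rightarrow> complex" and C :: real
  assumes g: "is_ft g G" and \<phi>: "is_ft \<phi> \<Phi>"
    and admissible: "has_bochner_integral lborel (\<lambda>w. (cmod (\<Phi> w))\<^sup>2 / \<bar>w\<bar>) C"
    and C_pos: "0 < C"
begin

text \<open>
  Here \<open>V\<close> is the wavelet transform without chirps, \<open>K a\<close> is the Fourier transform of \<open>V a\<close>,
  \<open>H t a\<close> is the inner integral of the reconstruction formula without the chirp in \<open>t\<close>, and \<open>M S\<close>
  is the Fourier multiplier produced by restricting the outer integral to \<open>a\<close> in \<open>S\<close>. The value
  \<open>M S 0\<close> is junk when the integral diverges, hence the hypotheses \<open>w \<noteq> 0\<close>.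
\<close>

definition P :: "real \<Rightarrow> real \<Rightarrow> real" where
  "P w a = (cmod (\<Phi> (a * w)))\<^sup>2 / \<bar>a\<bar>"

definition M :: "real set \<Rightarrow> real \<Rightarrow> real" where
  "M S w = (LINT a|lborel. indicator S a * P w a)"

definition V :: "real \<Rightarrow> real \<Rightarrow> complex" where
  "V a b = (LINT t|lborel. g t * cnj (\<phi> ((t - b) / a)))"

definition K :: "real \<Rightarrow> real \<Rightarrow> complex" where
  "K a w = G w * (of_real \<bar>a\<bar> * cnj (\<Phi> (a * w)))"

definition H :: "real \<Rightarrow> real \<Rightarrow> complex" where
  "H t a = of_real (1 / (2 * pi)) * (LINT w|lborel. G w * of_real (P w a) * cis (t * w))"

lemma meas [measurable]: "g \<in> borel_measurable borel" "G \<in> borel_measurable borel"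
  "\<phi> \<in> borel_measurable borel" "\<Phi> \<in> borel_measurable borel"
  using is_ft_L2[OF g] is_ft_L2[OF \<phi>] by measurable

section \<open>Bounds for the Fourier multiplier\<close>

lemma P_nonneg [simp]: "0 \<le> P w a" by (simp add: P_def)

lemma P_measurable [measurable]: "(\<lambda>x. P (f x) (h x)) \<in> borel_measurable N"
  if [measurable]: "f \<in> borel_measurable N" "h \<in> borel_measurable N"
  unfolding P_def by measurable

lemma P_integral:
  assumes "w \<noteq> 0" shows "has_bochner_integral lborel (P w) C"
proof -
  have "has_bochner_integral lborel (\<lambda>a. (cmod (\<Phi> (w * a)))\<^sup>2 / \<bar>w * a\<bar>) (C /\<^sub>R \<bar>w\<bar>)"
    using lborel_has_bochner_integral_real_affine_iff[OF assms, of "\<lambda>w. (cmod (\<Phi> w))\<^sup>2 / \<bar>w\<bar>" C 0] admissible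
    by simp
  from has_bochner_integral_mult_right[OF this, of "\<bar>w\<bar>"]
  have "has_bochner_integral lborel (P w) (\<bar>w\<bar> * (C /\<^sub>R \<bar>w\<bar>))"
    using assms by (simp add: P_def[abs_def] abs_mult mult.commute)
  also have "\<bar>w\<bar> * (C /\<^sub>R \<bar>w\<bar>) = C" using assms by simp
  finally show ?thesis .
qed

lemma P_set_integrable:
  assumes "w \<noteq> 0" and [measurable]: "S \<in> sets borel"
  shows "integrable lborel (\<lambda>a. indicator S a * P w a)"
proof (rule Bochner_Integration.integrable_bound)
  show "integrable lborel (P w)"
    using P_integral[OF assms(1)] by (simp add: has_bochner_integral_iff)
  show "AE a in lborel. norm (indicator S a * P w a) \<le> norm (P w a)"
    by (auto simp: indicator_def)
qed measurable

lemma M_nonneg: "0 \<le> M S w"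
  unfolding M_def by (intro Bochner_Integration.integral_nonneg) auto

lemma M_mono:
  assumes "w \<noteq> 0" "S \<in> sets borel" "T \<in> sets borel" "S \<subseteq> T" shows "M S w \<le> M T w"
  unfolding M_def using assms
  by (intro integral_mono P_set_integrable) (auto simp: indicator_def)

lemma M_UNIV: "w \<noteq> 0 \<Longrightarrow> M UNIV w = C"
  using P_integral by (simp add: M_def has_bochner_integral_iff)

lemma M_le_C: "w \<noteq> 0 \<Longrightarrow> S \<in> sets borel \<Longrightarrow> M S w \<le> C"
  using M_mono[of w S UNIV] M_UNIV by simp

text \<open>On \<open>S\<close> the weight \<open>1 / \<bar>a\<bar>\<close> is at most
  \<open>1 / \<eta>\<close>; what remains is the integral of the squared modulus of
  \<open>\<Phi> (w * a)\<close> over all \<open>a\<close>, which scales to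
  \<open>energy \<Phi> / \<bar>w\<bar>\<close>.\<close>

lemma M_decay:
  assumes w: "w \<noteq> 0" and S: "S \<in> sets borel" and \<eta>: "\<eta> > 0" "\<And>a. a \<in> S \<Longrightarrow> \<eta> \<le> \<bar>a\<bar>"
  shows "M S w \<le> energy \<Phi> / (\<eta> * \<bar>w\<bar>)"
proof -
  note 1 = L2_borel_affine[OF is_ft_L2(2)[OF \<phi>] w, of 0, simplified]
  have "M S w \<le> (LINT a|lborel. (1 / \<eta>) * (cmod (\<Phi> (w * a)))\<^sup>2)"
    unfolding M_def
  proof (rule integral_mono)
    show "integrable lborel (\<lambda>a. indicator S a * P w a)" by (rule P_set_integrable[OF w S])
    show "integrable lborel (\<lambda>a. 1 / \<eta> * (cmod (\<Phi> (w * a)))\<^sup>2)"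
      using L2_borel_integrable[OF 1(1)] by simp
    fix a
    show "indicator S a * P w a \<le> 1 / \<eta> * (cmod (\<Phi> (w * a)))\<^sup>2"
    proof (cases "a \<in> S")
      case True
      then have "(cmod (\<Phi> (w * a)))\<^sup>2 / \<bar>a\<bar> \<le> (cmod (\<Phi> (w * a)))\<^sup>2 / \<eta>"
        using \<eta>(1) \<eta>(2)[OF True] by (intro divide_left_mono) auto
      then show ?thesis using True by (simp add: P_def mult.commute)
    qed (use \<eta>(1) in simp)
  qed
  also have "\<dots> = (1 / \<eta>) * energy (\<lambda>a. \<Phi> (w * a))"
    unfolding energy_def by (rule integral_mult_right_zero)
  finally show ?thesis unfolding 1(2) by simp
qed

lemma M_measurable [measurable]:
  assumes [measurable]: "S \<in> sets borel" shows "M S \<in> borel_measurable borel"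
  unfolding M_def[abs_def] by measurable

text \<open>The bound \<open>C\<close> and the decay in \<open>1 / \<bar>w\<bar>\<close> combine to
  \<open>(M S w)\<^sup>2 * (1 + w\<^sup>2) \<le> D\<close>. Square-integrability of
  \<open>M S\<close> is what makes its product with \<open>G\<close> integrable in
  \<open>GM_L1\<close>.\<close>

lemma M_L2:
  assumes [measurable]: "S \<in> sets borel" and \<eta>: "\<eta> > 0" "\<And>a. a \<in> S \<Longrightarrow> \<eta> \<le> \<bar>a\<bar>"
  shows "L2_borel (\<lambda>w. of_real (M S w))"
proof (rule L2_borel_AE_bound)
  define D where "D = C\<^sup>2 + (energy \<Phi> / \<eta>)\<^sup>2"
  show "integrable lborel (\<lambda>w. D * (1 / (1 + w\<^sup>2)))"
    using integrable_inverse_1_plus_square' by (rule integrable_mult_right)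
  show "AE w in lborel. (cmod (complex_of_real (M S w)))\<^sup>2 \<le> D * (1 / (1 + w\<^sup>2))"
    using AE_nonzero
  proof eventually_elim
    case (elim w)
    have 1: "(M S w)\<^sup>2 \<le> C\<^sup>2"
      using M_le_C[OF elim assms(1)] M_nonneg[of S w] by (intro power_mono)
    have "M S w * \<bar>w\<bar> \<le> energy \<Phi> / \<eta>"
      using M_decay[OF elim assms(1) \<eta>] elim \<eta>(1) by (simp add: field_simps)
    then have "(M S w * \<bar>w\<bar>)\<^sup>2 \<le> (energy \<Phi> / \<eta>)\<^sup>2"
      using M_nonneg[of S w] by (intro power_mono) auto
    with 1 have "(M S w)\<^sup>2 * (1 + w\<^sup>2) \<le> D"
      by (simp add: D_def power_mult_distrib distrib_left)
    moreover have "1 + w\<^sup>2 > 0" by (simp add: add_pos_nonneg)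
    ultimately show ?case by (simp add: pos_le_divide_eq norm_of_real)
  qed
qed measurable

lemma GM_L1:
  assumes "S \<in> sets borel" "\<eta> > 0" "\<And>a. a \<in> S \<Longrightarrow> \<eta> \<le> \<bar>a\<bar>"
  shows "integrable lborel (\<lambda>w. G w * of_real (M S w))"
  by (rule L2_borel_mult_integrable[OF is_ft_L2(2)[OF g] M_L2[OF assms]])

lemma GM_L2:
  assumes [measurable]: "S \<in> sets borel"
  shows "L2_borel (\<lambda>w. G w * of_real (M S w))"
proof (rule L2_borel_AE_bound)
  show "integrable lborel (\<lambda>w. C\<^sup>2 * (cmod (G w))\<^sup>2)"
    using L2_borel_integrable[OF is_ft_L2(2)[OF g]] by simp
  show "AE w in lborel. (cmod (G w * of_real (M S w)))\<^sup>2 \<le> C\<^sup>2 * (cmod (G w))\<^sup>2"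
    using AE_nonzero
  proof eventually_elim
    case (elim w)
    have "(M S w)\<^sup>2 \<le> C\<^sup>2"
      using M_le_C[OF elim assms(1)] M_nonneg[of S w] by (intro power_mono)
    from mult_right_mono[OF this, of "(cmod (G w))\<^sup>2"] show ?case
      by (simp add: norm_mult power_mult_distrib mult.commute)
  qed
qed measurable

section \<open>The inner and the outer integral on the frequency side\<close>

lemma K_L1: assumes "a \<noteq> 0" shows "integrable lborel (K a)"
proof -
  have "L2_borel (\<lambda>w. cnj (\<Phi> (a * w)))"
    using L2_borel_cnj[OF L2_borel_affine(1)[OF is_ft_L2(2)[OF \<phi>] assms, of 0]] by simp
  from L2_borel_mult_integrable[OF is_ft_L2(2)[OF g] L2_borel_cmult[OF this]]
  show ?thesis by (simp add: K_def[abs_def])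
qed

lemma cmod_K_square: "a \<noteq> 0 \<Longrightarrow> (cmod (K a w))\<^sup>2 = \<bar>a\<bar> ^ 3 * ((cmod (G w))\<^sup>2 * P w a)"
  by (simp add: K_def P_def norm_mult power_mult_distrib power2_eq_square power3_eq_cube)

text \<open>For a single \<open>a\<close>, a product of two square-integrable functions need not be
  square-integrable. The double integral of \<open>(cmod (G w))\<^sup>2 * P w a\<close> is finite,
  namely \<open>C * energy G\<close>, so the section at almost every \<open>a\<close> is
  integrable.\<close>

lemma K_L2: "AE a in lborel. L2_borel (K a)"
proof -
  have L2G: "integrable lborel (\<lambda>w. (cmod (G w))\<^sup>2)" by (rule L2_borel_integrable[OF is_ft_L2(2)[OF g]])
  have "integrable (lborel \<Otimes>\<^sub>M lborel) (\<lambda>(w, a). (cmod (G w))\<^sup>2 * P w a)"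
  proof (rule lborel_pair.Fubini_integrable)
    show "AE w in lborel. integrable lborel (\<lambda>a. case (w, a) of (w, a) \<Rightarrow> (cmod (G w))\<^sup>2 * P w a)"
      using AE_nonzero by eventually_elim (use P_integral in \<open>auto simp: has_bochner_integral_iff\<close>)
    have "integrable lborel (\<lambda>w. C * (cmod (G w))\<^sup>2)" using L2G by simp
    then show "integrable lborel (\<lambda>w. LINT a|lborel. norm (case (w, a) of (w, a) \<Rightarrow> (cmod (G w))\<^sup>2 * P w a))"
    proof (rule integrable_cong_AE_imp)
      show "AE w in lborel. C * (cmod (G w))\<^sup>2 = (LINT a|lborel. norm (case (w, a) of (w, a) \<Rightarrow> (cmod (G w))\<^sup>2 * P w a))"
        using AE_nonzero by eventually_elim
          (use P_integral in \<open>auto simp: has_bochner_integral_iff abs_mult mult.commute\<close>)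
    qed measurable
  qed measurable
  from lborel_pair.AE_integrable_snd[OF this]
  have "AE a in lborel. integrable lborel (\<lambda>w. (cmod (G w))\<^sup>2 * P w a)" by simp
  then show ?thesis using AE_nonzero
  proof eventually_elim
    case (elim a)
    have [measurable]: "K a \<in> borel_measurable borel" unfolding K_def[abs_def] by measurable
    show ?case unfolding L2_borel_def cmod_K_square[OF elim(2)] using elim(1) by simp
  qed
qed

text \<open>Parseval's identity for \<open>g\<close> and the dilated, translated wavelet;
  conjugating the phase \<open>cis (- (b * w))\<close> of the translation turns the argument into
  \<open>- b\<close>.\<close>

lemma V_eq:
  assumes a: "a \<noteq> 0"
  shows "V a b = of_real (1 / (2 * pi)) * ft (K a) (- b)"
proof -
  have "ft (K a) (- b) = (LINT w|lborel. G w * cnj (of_real \<bar>a\<bar> * cis (- (b * w)) * \<Phi> (a * w)))"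
    unfolding ft_def K_def by (intro Bochner_Integration.integral_cong[OF refl]) (simp add: cis_cnj)
  also have "\<dots> = of_real (2 * pi) * V a b"
    unfolding V_def by (rule is_ft_Parseval[OF g is_ft_affine[OF \<phi> a]])
  finally show ?thesis by simp
qed

text \<open>After reflecting \<open>b\<close>, the function \<open>V a\<close> is a multiple of
  \<open>ft (K a)\<close>, and the multiplication formula moves the transform onto the wavelet. Of
  the factor \<open>\<bar>a\<bar> ^ 3\<close>, one power comes from \<open>K a\<close>, one from the
  dilated wavelet, and one offsets the denominator of \<open>P\<close>.\<close>

lemma inner_integral:
  assumes a: "a \<noteq> 0" and K: "L2_borel (K a)"
  shows "has_bochner_integral lborel (\<lambda>b. V a b * \<phi> ((t - b) / a)) (of_real (\<bar>a\<bar> ^ 3) * H t a)"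
proof -
  note KL = K_L1[OF a] K
  \<comment> \<open>Here \<open>\<psi> (- b)\<close> is \<open>\<phi> ((t - b) / a)\<close>; writing
    the shift as subtraction of \<open>- t\<close> fits the form of
    \<open>is_ft_affine\<close>.\<close>
  define \<psi> where "\<psi> b = \<phi> ((b - (- t)) / a)" for b
  have \<psi>: "is_ft \<psi> (\<lambda>w. of_real \<bar>a\<bar> * cis (- (- t * w)) * \<Phi> (a * w))"
    unfolding \<psi>_def[abs_def] by (rule is_ft_affine[OF \<phi> a])
  have "has_bochner_integral lborel (\<lambda>b. ft (K a) b * \<psi> b) (LINT b|lborel. ft (K a) b * \<psi> b)"
    by (intro has_bochner_integral_integrable L2_borel_mult_integrable Plancherel_L1 KL is_ft_L2[OF \<psi>])
  also have "(LINT b|lborel. ft (K a) b * \<psi> b) = (LINT w|lborel. K a w * (of_real \<bar>a\<bar> * cis (- (- t * w)) * \<Phi> (a * w)))"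
    by (rule is_ft_multiplication[OF KL \<psi>])
  also have "\<dots> = (LINT w|lborel. of_real (\<bar>a\<bar> ^ 3) * (G w * of_real (P w a) * cis (t * w)))"
  proof (rule Bochner_Integration.integral_cong[OF refl])
    fix w
    have "of_real (\<bar>a\<bar> ^ 3 * P w a) = of_real \<bar>a\<bar> * of_real \<bar>a\<bar> * (\<Phi> (a * w) * cnj (\<Phi> (a * w)))"
      unfolding complex_norm_square[symmetric] using a
      by (simp add: P_def power3_eq_cube flip: of_real_mult of_real_power)
    then show "K a w * (of_real \<bar>a\<bar> * cis (- (- t * w)) * \<Phi> (a * w)) = of_real (\<bar>a\<bar> ^ 3) * (G w * of_real (P w a) * cis (t * w))"
      by (simp add: K_def)
  qed
  also have "\<dots> = of_real (\<bar>a\<bar> ^ 3) * (LINT w|lborel. G w * of_real (P w a) * cis (t * w))"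
    by (rule integral_mult_right_zero)
  finally have "has_bochner_integral lborel (\<lambda>b. ft (K a) (- b) * \<psi> (- b)) (of_real (\<bar>a\<bar> ^ 3) * (LINT w|lborel. G w * of_real (P w a) * cis (t * w)))"
    using lborel_has_bochner_integral_real_affine_iff[of "-1" "\<lambda>b. ft (K a) b * \<psi> b" _ 0] by simp
  from has_bochner_integral_mult_right[OF this, of "of_real (1 / (2 * pi))"]
  show ?thesis
    by (simp add: V_eq[OF a] H_def \<psi>_def mult_ac)
qed

text \<open>The phase has modulus 1, so absolute convergence of the double integral amounts to
  integrability of the product of \<open>G\<close> and \<open>M S\<close>, and holds for every
  \<open>t\<close>, not just for almost every one.\<close>

lemma outer_integral:
  assumes [measurable]: "S \<in> sets borel" and \<eta>: "\<eta> > 0" "\<And>a. a \<in> S \<Longrightarrow> \<eta> \<le> \<bar>a\<bar>"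
  shows "has_bochner_integral lborel (\<lambda>a. indicator S a *\<^sub>R H t a)
     (of_real (1 / (2 * pi)) * ft (\<lambda>w. G w * of_real (M S w)) (- t))"
proof -
  let ?F = "\<lambda>w a. G w * of_real (indicator S a * P w a) * cis (t * w)"
  have i: "integrable (lborel \<Otimes>\<^sub>M lborel) (case_prod ?F)"
  proof (rule lborel_pair.Fubini_integrable)
    show "AE w in lborel. integrable lborel (\<lambda>a. case (w, a) of (w, a) \<Rightarrow> ?F w a)"
      using AE_nonzero
    proof eventually_elim
      case (elim w)
      have "integrable lborel (\<lambda>a. complex_of_real (indicator S a * P w a))"
        by (intro integrable_of_real P_set_integrable elim) simp
      then show ?case by simp
    qed
    have eq: "(LINT a|lborel. norm (case (w, a) of (w, a) \<Rightarrow> ?F w a)) = cmod (G w * of_real (M S w))" for w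
    proof -
      have "(LINT a|lborel. norm (case (w, a) of (w, a) \<Rightarrow> ?F w a)) = (LINT a|lborel. cmod (G w) * (indicator S a * P w a))"
        by (intro Bochner_Integration.integral_cong[OF refl]) (simp add: norm_mult indicator_def)
      also have "\<dots> = cmod (G w) * M S w" unfolding M_def by (rule integral_mult_right_zero)
      finally show ?thesis using M_nonneg[of S w] by (simp add: norm_mult)
    qed
    show "integrable lborel (\<lambda>w. LINT a|lborel. norm (case (w, a) of (w, a) \<Rightarrow> ?F w a))"
      unfolding eq by (intro integrable_norm GM_L1[OF _ \<eta>]) simp_all
  qed measurable
  have H: "of_real (1 / (2 * pi)) * (LINT w|lborel. ?F w a) = indicator S a *\<^sub>R H t a" for a
    by (cases "a \<in> S") (simp_all add: H_def)
  have "(LINT a|lborel. LINT w|lborel. ?F w a) = (LINT w|lborel. LINT a|lborel. ?F w a)"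
    by (rule lborel_pair.Fubini_integral[OF i])
  also have "\<dots> = (LINT w|lborel. G w * of_real (M S w) * cis (- (- t * w)))"
    by (simp add: M_def flip: integral_complex_of_real del: of_real_mult)
  finally have "has_bochner_integral lborel (\<lambda>a. LINT w|lborel. ?F w a) (ft (\<lambda>w. G w * of_real (M S w)) (- t))"
    using lborel_pair.integrable_snd[OF i] by (simp add: has_bochner_integral_iff ft_def)
  from has_bochner_integral_mult_right[OF this, of "of_real (1 / (2 * pi))"]
  show ?thesis unfolding H .
qed

text \<open>For Borel \<open>S\<close> bounded away from 0 this is \<open>1 / C\<close> times the
  integral of \<open>H t\<close> over \<open>S\<close>, in the closed form of
  \<open>outer_integral\<close>.\<close>

definition R :: "real set \<Rightarrow> real \<Rightarrow> complex" where
  "R S t = of_real (1 / (2 * pi * C)) * ft (\<lambda>w. G w * of_real (M S w)) (- t)"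

lemma R_L2:
  assumes "S \<in> sets borel" "\<eta> > 0" "\<And>a. a \<in> S \<Longrightarrow> \<eta> \<le> \<bar>a\<bar>"
  shows "L2_borel (R S)"
proof -
  have "L2_borel (ft (\<lambda>w. G w * of_real (M S w)))"
    by (rule Plancherel_L1(1)[OF GM_L1[OF assms] GM_L2[OF assms(1)]])
  from L2_borel_cmult[OF L2_borel_affine(1)[OF this, of "-1" 0], of "of_real (1 / (2 * pi * C))"]
  show ?thesis by (simp add: R_def[abs_def])
qed

lemma R_error:
  assumes S: "S \<in> sets borel" "\<eta> > 0" "\<And>a. a \<in> S \<Longrightarrow> \<eta> \<le> \<bar>a\<bar>"
  shows "energy (\<lambda>t. R S t - g t) = energy (\<lambda>w. of_real (1 / C) * (G w * of_real (M S w)) - G w) / (2 * pi)"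
proof -
  have ft: "ft (\<lambda>w. of_real (1 / C) * (G w * of_real (M S w))) t = of_real (1 / C) * ft (\<lambda>w. G w * of_real (M S w)) t" for t
    unfolding ft_def mult.assoc by (rule integral_mult_right_zero)
  have "R S t = ft (\<lambda>w. of_real (1 / C) * (G w * of_real (M S w))) (- t) / of_real (2 * pi)" for t
    unfolding ft R_def by simp
  then show ?thesis
    using energy_inversion[OF integrable_mult_right[OF GM_L1[OF S]] L2_borel_cmult[OF GM_L2[OF S(1)]] g, of "of_real (1 / C)"]
    by simp
qed

text \<open>On the frequency side the error has modulus \<open>cmod (G w) * (1 - M S w / C)\<close>,
  and \<open>M S w / C\<close> grows with \<open>S\<close> without exceeding 1. This monotonicity
  handles the two independent cut-offs: every pair below \<open>s n\<close> is controlled by the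
  symmetric cut-off at \<open>s n\<close>.\<close>

lemma R_error_mono:
  assumes S: "S \<in> sets borel" "\<eta> > 0" "\<And>a. a \<in> S \<Longrightarrow> \<eta> \<le> \<bar>a\<bar>"
    and T: "T \<in> sets borel" "\<theta> > 0" "\<And>a. a \<in> T \<Longrightarrow> \<theta> \<le> \<bar>a\<bar>" and "S \<subseteq> T"
  shows "energy (\<lambda>t. R T t - g t) \<le> energy (\<lambda>t. R S t - g t)"
proof -
  let ?D = "\<lambda>S w. of_real (1 / C) * (G w * of_real (M S w)) - G w"
  have L2: "L2_borel (?D S)" if "S \<in> sets borel" for S
    by (rule L2_borel_diff[OF L2_borel_cmult[OF GM_L2[OF that]] is_ft_L2(2)[OF g]])
  have "energy (?D T) \<le> energy (?D S)"
    unfolding energy_def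
  proof (rule integral_mono_AE)
    show "AE w in lborel. (cmod (?D T w))\<^sup>2 \<le> (cmod (?D S w))\<^sup>2"
      using AE_nonzero
    proof eventually_elim
      case (elim w)
      have D: "cmod (?D S w) = cmod (G w) * (1 - M S w / C)" if "S \<in> sets borel" for S
      proof -
        have "?D S w = - (G w * of_real (1 - M S w / C))" by (simp add: algebra_simps)
        moreover have "M S w / C \<le> 1" using M_le_C[OF elim that] C_pos by (simp add: divide_le_eq)
        ultimately show ?thesis by (simp only: norm_minus_cancel norm_mult norm_of_real)
      qed
      have "M S w / C \<le> M T w / C" using M_mono[OF elim S(1) T(1) \<open>S \<subseteq> T\<close>] C_pos by (simp add: divide_right_mono)
      moreover have "M T w / C \<le> 1" using M_le_C[OF elim T(1)] C_pos by (simp add: divide_le_eq)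
      ultimately show ?case unfolding D[OF S(1)] D[OF T(1)]
        by (intro power_mono mult_left_mono) auto
    qed
  qed (use L2_borel_integrable[OF L2] S(1) T(1) in auto)
  then have "energy (?D T) / (2 * pi) \<le> energy (?D S) / (2 * pi)"
    by (rule divide_right_mono) simp
  moreover have "energy (\<lambda>t. R S t - g t) = energy (?D S) / (2 * pi)"
    "energy (\<lambda>t. R T t - g t) = energy (?D T) / (2 * pi)"
    using R_error[OF S] R_error[OF T] by -
  ultimately show ?thesis by (simp only:)
qed

section \<open>Removing the cut-off at the origin\<close>

definition away :: "real \<Rightarrow> real \<Rightarrow> real set" where
  "away \<delta> \<epsilon> = {..-\<delta>} \<union> {\<epsilon>..}"

lemma away_borel [measurable]: "away \<delta> \<epsilon> \<in> sets borel"
  by (simp add: away_def)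

lemma away_bound: "a \<in> away \<delta> \<epsilon> \<Longrightarrow> min \<delta> \<epsilon> \<le> \<bar>a\<bar>"
  by (auto simp: away_def)

lemma R_error_seq: "(\<lambda>n. energy (\<lambda>t. R (away (1 / real (Suc n)) (1 / real (Suc n))) t - g t)) \<longlonglongrightarrow> 0"
proof -
  define s where "s n = 1 / real (Suc n)" for n
  have s: "s n > 0" for n by (simp add: s_def)
  have s0: "s \<longlonglongrightarrow> 0" unfolding s_def by (rule LIMSEQ_Suc[OF lim_1_over_n])
  let ?A = "\<lambda>n. away (s n) (s n)"
  have Mlim: "(\<lambda>n. M (?A n) w) \<longlonglongrightarrow> C" if w: "w \<noteq> 0" for w
  proof -
    have "(\<lambda>n. LINT a|lborel. indicator (?A n) a * P w a) \<longlonglongrightarrow> (LINT a|lborel. P w a)"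
    proof (rule integral_dominated_convergence)
      show "integrable lborel (P w)" using P_integral[OF w] by (simp add: has_bochner_integral_iff)
      show "AE a in lborel. (\<lambda>n. indicator (?A n) a * P w a) \<longlonglongrightarrow> P w a"
        using AE_nonzero
      proof eventually_elim
        case (elim a)
        then have "\<forall>\<^sub>F n in sequentially. s n < \<bar>a\<bar>" by (intro order_tendstoD(2)[OF s0]) simp
        then have "\<forall>\<^sub>F n in sequentially. indicator (?A n) a * P w a = P w a"
          by eventually_elim (auto simp: away_def indicator_def abs_if split: if_splits)
        then show ?case by (rule tendsto_eventually)
      qed
      show "AE a in lborel. norm (indicator (?A n) a * P w a) \<le> P w a" for n
        by (auto simp: indicator_def)
    qed measurable
    then show ?thesis
      using P_integral[OF w] by (simp add: M_def[symmetric] has_bochner_integral_iff)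
  qed
  \<comment> \<open>The bounds on \<open>M\<close> are available only for
    \<open>w \<noteq> 0\<close>, while \<open>energy_dominated_convergence\<close> wants its bound
    at every point; the value at \<open>w = 0\<close> is therefore set to 0.\<close>
  define G' where "G' n w = (if w = 0 then 0 else of_real (1 / C) * (G w * of_real (M (?A n) w)))" for n w
  have "(\<lambda>n. energy (\<lambda>w. G' n w - G w)) \<longlonglongrightarrow> 0"
  proof (rule energy_dominated_convergence[where w = "\<lambda>w. cmod (G w)"])
    show "AE w in lborel. (\<lambda>n. G' n w) \<longlonglongrightarrow> G w"
      using AE_nonzero
    proof eventually_elim
      case (elim w)
      have "(\<lambda>n. of_real (1 / C) * (G w * of_real (M (?A n) w))) \<longlonglongrightarrow> of_real (1 / C) * (G w * of_real C)"
        by (intro tendsto_intros Mlim elim)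
      then show ?case using C_pos elim by (simp add: G'_def)
    qed
    show "cmod (G' n w) \<le> cmod (G w)" for n w
    proof (cases "w = 0")
      case False
      have "M (?A n) w / C \<le> 1" using M_le_C[OF False away_borel] C_pos by (simp add: divide_le_eq)
      from mult_left_mono[OF this, of "cmod (G w)"] show ?thesis
        using M_nonneg[of "?A n" w] C_pos False by (simp add: G'_def norm_mult norm_divide)
    qed (simp add: G'_def)
    show "integrable lborel (\<lambda>w. (cmod (G w))\<^sup>2)" by (rule L2_borel_integrable[OF is_ft_L2(2)[OF g]])
    show "G' n \<in> borel_measurable borel" for n unfolding G'_def[abs_def] by measurable
  qed measurable
  moreover have "energy (\<lambda>w. G' n w - G w) = energy (\<lambda>w. of_real (1 / C) * (G w * of_real (M (?A n) w)) - G w)" for n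
    unfolding energy_def
  proof (rule integral_cong_AE)
    show "AE w in lborel. (cmod (G' n w - G w))\<^sup>2 = (cmod (of_real (1 / C) * (G w * of_real (M (?A n) w)) - G w))\<^sup>2"
      using AE_nonzero by eventually_elim (simp add: G'_def)
    show "(\<lambda>w. (cmod (G' n w - G w))\<^sup>2) \<in> borel_measurable lborel" unfolding G'_def[abs_def] by measurable
  qed measurable
  ultimately have "(\<lambda>n. energy (\<lambda>w. of_real (1 / C) * (G w * of_real (M (?A n) w)) - G w) / (2 * pi)) \<longlonglongrightarrow> 0 / (2 * pi)"
    by (intro tendsto_divide tendsto_const) auto
  moreover have "energy (\<lambda>t. R (?A n) t - g t) = energy (\<lambda>w. of_real (1 / C) * (G w * of_real (M (?A n) w)) - G w) / (2 * pi)" for n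
    using away_bound[of _ "s n" "s n"] s[of n] by (intro R_error[of _ "s n"]) auto
  ultimately show ?thesis by (simp add: s_def)
qed

lemma R_tendsto:
  "((\<lambda>(\<delta>, \<epsilon>). energy (\<lambda>t. R (away \<delta> \<epsilon>) t - g t)) \<longlongrightarrow> 0) (at_right 0 \<times>\<^sub>F at_right 0)"
proof (rule order_tendstoI)
  fix e :: real assume "0 < e"
  define s where "s n = 1 / real (Suc n)" for n
  have s: "s n > 0" for n by (simp add: s_def)
  from order_tendstoD(2)[OF R_error_seq \<open>0 < e\<close>] obtain n
    where n: "energy (\<lambda>t. R (away (s n) (s n)) t - g t) < e"
    unfolding s_def using eventually_happens by force
  have "\<forall>\<^sub>F \<delta> in at_right 0. 0 < \<delta> \<and> \<delta> < s n"
    using s[of n] by (simp add: eventually_at_right_field) (metis dense less_trans)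
  then show "\<forall>\<^sub>F x in at_right 0 \<times>\<^sub>F at_right 0. (case x of (\<delta>, \<epsilon>) \<Rightarrow> energy (\<lambda>t. R (away \<delta> \<epsilon>) t - g t)) < e"
    unfolding eventually_prod_filter
  proof (intro exI conjI allI impI)
    fix \<delta> \<epsilon> :: real assume "0 < \<delta> \<and> \<delta> < s n" "0 < \<epsilon> \<and> \<epsilon> < s n"
    then have "energy (\<lambda>t. R (away \<delta> \<epsilon>) t - g t) \<le> energy (\<lambda>t. R (away (s n) (s n)) t - g t)"
      using away_bound[of _ "s n" "s n"] away_bound[of _ \<delta> \<epsilon>]
      by (intro R_error_mono[of _ "s n" _ "min \<delta> \<epsilon>"]) (auto simp: away_def)
    with n show "(case (\<delta>, \<epsilon>) of (\<delta>, \<epsilon>) \<Rightarrow> energy (\<lambda>t. R (away \<delta> \<epsilon>) t - g t)) < e" by simp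
  qed
qed (auto intro!: always_eventually intro: less_le_trans[OF _ energy_nonneg])

text \<open>Two limits of the same truncations are compared. Mean-square convergence gives a
  subsequence tending to \<open>g t\<close> for almost every \<open>t\<close>; where
  \<open>H t\<close> is integrable, its modulus dominates the truncations, which then tend to the
  full integral.\<close>

lemma pointwise:
  "AE t in lborel. integrable lborel (H t) \<longrightarrow> g t = of_real (1 / C) * (LINT a|lborel. H t a)"
proof -
  define s where "s n = 1 / real (Suc n)" for n
  have s: "s n > 0" for n by (simp add: s_def)
  have s0: "s \<longlonglongrightarrow> 0" unfolding s_def by (rule LIMSEQ_Suc[OF lim_1_over_n])
  let ?A = "\<lambda>n. away (s n) (s n)"
  have A: "a \<in> ?A n \<Longrightarrow> s n \<le> \<bar>a\<bar>" for a n using away_bound[of a "s n" "s n"] by simp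
  have L2: "L2_borel (\<lambda>t. R (?A n) t - g t)" for n
    by (rule L2_borel_diff[OF R_L2[OF away_borel s A] is_ft_L2(1)[OF g]])
  have "\<exists>r. strict_mono r \<and> (AE t in lborel. (\<lambda>n. (cmod (R (?A (r n)) t - g t))\<^sup>2) \<longlonglongrightarrow> 0)"
  proof (rule tendsto_L1_AE_subseq)
    show "integrable lborel (\<lambda>t. (cmod (R (?A n) t - g t))\<^sup>2)" for n by (rule L2_borel_integrable[OF L2])
    show "(\<lambda>n. LINT t|lborel. norm ((cmod (R (?A n) t - g t))\<^sup>2)) \<longlonglongrightarrow> 0"
      using R_error_seq by (simp add: energy_def s_def)
  qed
  then obtain r where r: "strict_mono r" "AE t in lborel. (\<lambda>n. (cmod (R (?A (r n)) t - g t))\<^sup>2) \<longlonglongrightarrow> 0"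
    by blast
  from r(2) show ?thesis
  proof eventually_elim
    case (elim t)
    show ?case
    proof
      assume int: "integrable lborel (H t)"
      have Heq: "R (?A n) t = of_real (1 / C) * (LINT a|lborel. indicator (?A n) a *\<^sub>R H t a)" for n
        using outer_integral[OF away_borel s[of n] A[where n = n], where t = t] by (simp add: has_bochner_integral_iff R_def)
      have "(\<lambda>n. LINT a|lborel. indicator (?A n) a *\<^sub>R H t a) \<longlonglongrightarrow> (LINT a|lborel. H t a)"
      proof (rule integral_dominated_convergence)
        show "integrable lborel (\<lambda>a. cmod (H t a))" using int by (rule integrable_norm)
        show "AE a in lborel. (\<lambda>n. indicator (?A n) a *\<^sub>R H t a) \<longlonglongrightarrow> H t a"
          using AE_nonzero
        proof eventually_elim
          case (elim a)
          then have "\<forall>\<^sub>F n in sequentially. s n < \<bar>a\<bar>" by (intro order_tendstoD(2)[OF s0]) simp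
          then have "\<forall>\<^sub>F n in sequentially. indicator (?A n) a *\<^sub>R H t a = H t a"
            by eventually_elim (auto simp: away_def indicator_def abs_if split: if_splits)
          then show ?case by (rule tendsto_eventually)
        qed
        show "AE a in lborel. norm (indicator (?A n) a *\<^sub>R H t a) \<le> cmod (H t a)" for n
          by (auto simp: indicator_def)
        show "H t \<in> borel_measurable lborel" using int by auto
        then show "(\<lambda>a. indicator (?A n) a *\<^sub>R H t a) \<in> borel_measurable lborel" for n by measurable
      qed
      then have "(\<lambda>n. R (?A n) t) \<longlonglongrightarrow> of_real (1 / C) * (LINT a|lborel. H t a)"
        unfolding Heq by (intro tendsto_mult tendsto_const)
      from LIMSEQ_subseq_LIMSEQ[OF this r(1)]
      have "(\<lambda>n. R (?A (r n)) t) \<longlonglongrightarrow> of_real (1 / C) * (LINT a|lborel. H t a)" by (simp add: o_def)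
      moreover have "(\<lambda>n. R (?A (r n)) t) \<longlonglongrightarrow> g t"
      proof -
        from tendsto_real_sqrt[OF elim] have "(\<lambda>n. R (?A (r n)) t - g t) \<longlonglongrightarrow> 0"
          by (simp add: tendsto_norm_zero_iff)
        then show ?thesis by (rule LIM_zero_cancel)
      qed
      ultimately show "g t = of_real (1 / C) * (LINT a|lborel. H t a)" using LIMSEQ_unique by blast
    qed
  qed
qed

end

section \<open>Borel representatives of Lebesgue measurable functions\<close>

text \<open>Lebesgue measure is complete, so even the measurability of \<open>f\<close> follows from
  its agreement with \<open>f'\<close> off a null set. Integrals are carried between the two
  measures by these three facts.\<close>

lemma lebesgue_AE_eq_borel:
  fixes f f' :: "real \<Rightarrow> 'a::euclidean_space"
  assumes f': "f' \<in> borel_measurable borel" and eq: "AE x in lborel. f x = f' x"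
  shows "f \<in> borel_measurable lebesgue"
    "integrable lebesgue f \<longleftrightarrow> integrable lborel f'"
    "(LINT x|lebesgue. f x) = (LINT x|lborel. f' x)"
proof -
  have m': "f' \<in> borel_measurable lebesgue" using f' by (simp add: measurable_completion)
  have ae: "AE x in lebesgue. f' x = f x"
    using eq by (simp add: AE_completion_iff eq_commute)
  show m: "f \<in> borel_measurable lebesgue"
    by (rule borel_measurable_AE[OF m' ae])
  show "integrable lebesgue f \<longleftrightarrow> integrable lborel f'"
    using integrable_cong_AE[OF m' m ae] integrable_completion[of f' lborel] f' by simp
  show "(LINT x|lebesgue. f x) = (LINT x|lborel. f' x)"
    using integral_cong_AE[OF m' m ae] integral_completion[of f' lborel] f' by simp
qed

lemma lebesgue_ex_borel:
  fixes f :: "real \<Rightarrow> complex"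
  assumes "f \<in> borel_measurable lebesgue"
  shows "\<exists>f'\<in>borel_measurable borel. AE x in lborel. f x = f' x"
proof -
  have "(\<lambda>x. Re (f x)) \<in> borel_measurable lebesgue" "(\<lambda>x. Im (f x)) \<in> borel_measurable lebesgue"
    using assms by measurable
  then obtain u v where [measurable]: "u \<in> borel_measurable lborel" "v \<in> borel_measurable lborel"
    and u: "AE x in lborel. Re (f x) = u x" and v: "AE x in lborel. Im (f x) = v x"
    using completion_ex_borel_measurable_real by metis
  have "AE x in lborel. f x = Complex (u x) (v x)"
    using u v by eventually_elim (simp add: complex_eq_iff)
  moreover have "(\<lambda>x. Complex (u x) (v x)) = (\<lambda>x. of_real (u x) + \<i> * of_real (v x))"
    by (simp add: complex_eq_iff fun_eq_iff)
  moreover have "(\<lambda>x. complex_of_real (u x) + \<i> * of_real (v x)) \<in> borel_measurable borel"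
    by measurable
  ultimately show ?thesis by metis
qed

lemma square_integrable_AE_eq:
  assumes f': "f' \<in> borel_measurable borel" and eq: "AE x in lborel. f x = f' x"
  shows "square_integrable f \<longleftrightarrow> L2_borel f'" "L2_norm f = sqrt (energy f')"
proof -
  have m: "(\<lambda>x. (cmod (f' x))\<^sup>2) \<in> borel_measurable borel" using f' by measurable
  have ae: "AE x in lborel. (cmod (f x))\<^sup>2 = (cmod (f' x))\<^sup>2" using eq by eventually_elim simp
  show "square_integrable f \<longleftrightarrow> L2_borel f'"
    using lebesgue_AE_eq_borel[OF f' eq] lebesgue_AE_eq_borel[OF m ae] f'
    by (simp add: square_integrable_def L2_borel_def)
  show "L2_norm f = sqrt (energy f')"
    using lebesgue_AE_eq_borel(3)[OF m ae] by (simp add: L2_norm_def energy_def)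
qed

lemma square_integrable_ex_borel:
  assumes "square_integrable f"
  obtains f' where "L2_borel f'" "AE x in lborel. f x = f' x"
  using assms lebesgue_ex_borel square_integrable_AE_eq(1) by (metis square_integrable_def)

text \<open>The exceptional set need not be Borel, so it is first enclosed in a Borel null set,
  whose preimage under the affine map is again null.\<close>

lemma AE_lborel_affine:
  assumes "AE x in lborel. P x" "c \<noteq> 0"
  shows "AE x in lborel. P (t + c * x :: real)"
proof -
  obtain N where N: "{x \<in> space lborel. \<not> P x} \<subseteq> N" "emeasure lborel N = 0" "N \<in> sets lborel"
    using AE_E[OF assms(1)] .
  have [measurable]: "N \<in> sets borel" using N(3) by simp
  have "AE x in lborel. x \<notin> N" using N(2,3) by (intro AE_not_in) auto
  then have "AE x in lborel. t + c * x \<notin> N"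
    by (intro AE_borel_affine[OF assms(2)]) measurable
  then show ?thesis by eventually_elim (use N(1) in auto)
qed

text \<open>By \<open>is_ft_exists\<close> the choice in \<open>fourier_L2\<close> is made from a
  nonempty set, so \<open>fourier_L2 f\<close> really is the limit of the truncated transforms. The
  chosen function need not be Borel; \<open>F\<close> is a Borel function equal to it almost
  everywhere, and the truncations at natural numbers witness \<open>is_ft\<close>.\<close>

theorem fourier_L2_is_ft:
  assumes f': "L2_borel f'" and eq: "AE x in lborel. f x = f' x"
  obtains F where "is_ft f' F" "AE w in lborel. fourier_L2 f w = F w"
proof -
  define X where "X r w = (LINT t:{-r..r}|lebesgue. f t * cis (- (w * t)))" for r w :: real
  have [measurable]: "f' \<in> borel_measurable borel" using f' by measurable
  \<comment> \<open>Equality at every \<open>w\<close>: the integral does not see the null set where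
    \<open>f\<close> and \<open>f'\<close> differ.\<close>
  have X: "X r = ft (trunc r f')" for r
  proof
    fix w
    show "X r w = ft (trunc r f') w"
      unfolding X_def ft_def set_lebesgue_integral_def
    proof (rule lebesgue_AE_eq_borel(3))
      show "AE t in lborel. indicator {-r..r} t *\<^sub>R (f t * cis (- (w * t))) = trunc r f' t * cis (- (w * t))"
        using eq by eventually_elim (simp add: trunc_def indicator_def)
      show "(\<lambda>t. trunc r f' t * cis (- (w * t))) \<in> borel_measurable borel"
        unfolding trunc_def by measurable
    qed
  qed
  have XL2: "L2_borel (X r)" for r
    unfolding X by (rule Plancherel_L1(1)[OF trunc_L2(2,1)[OF f']])
  have sqX: "square_integrable (X r)" for r
    using XL2[of r] square_integrable_AE_eq(1)[of "X r" "X r"] by (simp add: L2_borel_def)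
  obtain F where F: "is_ft f' F" using is_ft_exists[OF f'] by blast
  have normX: "L2_norm (\<lambda>w. X r w - Y w) = sqrt (energy (\<lambda>w. X r w - Y' w))"
    if "L2_borel Y'" "AE w in lborel. Y w = Y' w" for r Y Y'
  proof (rule square_integrable_AE_eq(2))
    show "(\<lambda>w. X r w - Y' w) \<in> borel_measurable borel"
      using L2_borel_diff[OF XL2 that(1)] by (simp add: L2_borel_def)
    show "AE w in lborel. X r w - Y w = X r w - Y' w" using that(2) by eventually_elim simp
  qed
  have "L2_tendsto X F at_top"
    unfolding L2_tendsto_def
  proof (intro conjI)
    show "square_integrable F"
      using square_integrable_AE_eq(1)[of F F] is_ft_L2(2)[OF F] by (simp add: L2_borel_def)
    show "((\<lambda>r. L2_norm (\<lambda>w. X r w - F w)) \<longlongrightarrow> 0) at_top"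
      using tendsto_real_sqrt[OF ft_trunc_tendsto[OF F]] is_ft_L2(2)[OF F]
      by (simp add: normX X[symmetric])
  qed (simp add: sqX)
  then have lim: "L2_tendsto X (fourier_L2 f) at_top"
    using someI[of "\<lambda>F. L2_tendsto X F at_top"] by (simp add: fourier_L2_def X_def[abs_def])
  then obtain F' where F': "L2_borel F'" "AE w in lborel. fourier_L2 f w = F' w"
    by (auto simp: L2_tendsto_def elim: square_integrable_ex_borel)
  have "((\<lambda>r. (L2_norm (\<lambda>w. X r w - fourier_L2 f w))\<^sup>2) \<longlongrightarrow> 0\<^sup>2) at_top"
    using lim by (intro tendsto_power) (simp add: L2_tendsto_def)
  then have "((\<lambda>r. energy (\<lambda>w. X r w - F' w)) \<longlongrightarrow> 0) at_top"
    by (simp add: normX[OF F'])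
  from filterlim_compose[OF this filterlim_real_sequentially]
  have "(\<lambda>n. energy (\<lambda>w. ft (trunc (real n) f') w - F' w)) \<longlonglongrightarrow> 0" by (simp add: X)
  then have "is_ft f' F'"
    by (intro is_ftI[where k = "\<lambda>n. trunc (real n) f'"] f' F'(1) trunc_L2 trunc_nat_tendsto)
  with F'(2) show thesis using that by blast
qed

section \<open>The fractional wavelet transform\<close>

definition chirp :: "real \<Rightarrow> real \<Rightarrow> complex" where
  "chirp c t = cis (- (t\<^sup>2 * c / 2))"

lemma chirp_norm [simp]: "cmod (chirp c t) = 1" by (simp add: chirp_def)

lemma chirp_nonzero [simp]: "chirp c t \<noteq> 0" by (simp add: chirp_def)

lemma chirp_mult_cnj [simp]: "chirp c t * cnj (chirp c t) = 1" "cnj (chirp c t) * chirp c t = 1"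
  by (simp_all add: chirp_def cis_cnj cis_mult)

lemma chirp_measurable [measurable]: "chirp c \<in> borel_measurable borel"
  unfolding chirp_def[abs_def] by measurable

text \<open>The exponent splits into a term in \<open>t\<close> and a term in \<open>b\<close>. The
  chirp in \<open>t\<close> can thus be pulled out of the integrals over \<open>a\<close> and
  \<open>b\<close>, and the one in \<open>b\<close> meets its conjugate from the transform.\<close>

lemma frac_wavelet_eq:
  "frac_wavelet \<alpha> \<rho> \<phi> a b t =
     chirp (cot (\<alpha> * pi / 2)) t * cnj (chirp (cot (\<alpha> * pi / 2)) b) * of_real (\<bar>a\<bar> powr (- \<rho>)) * \<phi> ((t - b) / a)"
proof -
  have "exp (- (\<i> / 2) * of_real ((t\<^sup>2 - b\<^sup>2) * c)) = chirp c t * cnj (chirp c b)" for c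
  proof -
    have "- (\<i> / 2) * of_real ((t\<^sup>2 - b\<^sup>2) * c) = \<i> * of_real (- (t\<^sup>2 * c / 2) + b\<^sup>2 * c / 2)"
      by (simp add: field_simps)
    then show ?thesis
      by (simp only: cis_conv_exp[symmetric]) (simp add: chirp_def cis_cnj cis_mult)
  qed
  then show ?thesis by (simp add: frac_wavelet_def)
qed

theorem theorem1p2:
  fixes \<alpha> \<rho> :: real and \<phi> h :: "real \<Rightarrow> complex"
  assumes "sin (\<alpha> * pi / 2) \<noteq> 0"
    and "\<rho> \<ge> 0"
    and "wavelet \<phi>"
    and "square_integrable h"
  shows "reconstructs (C_adm \<phi>)
    (\<lambda>t a b. GNFrWT \<alpha> \<rho> \<phi> h a b * frac_wavelet \<alpha> \<rho> \<phi> a b t * of_real (\<bar>a\<bar> powr (2 * \<rho> - 3)))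
    h"
proof -
  define C where "C = C_adm \<phi>"
  define E where "E = chirp (cot (\<alpha> * pi / 2))"
  have [measurable]: "E \<in> borel_measurable borel" by (simp add: E_def)
  have E: "cmod (E t) = 1" "E t \<noteq> 0" "E t * cnj (E t) = 1" "cnj (E t) * E t = 1" for t
    by (simp_all add: E_def)
  have fw: "frac_wavelet \<alpha> \<rho> \<phi> a b t = E t * cnj (E b) * of_real (\<bar>a\<bar> powr (- \<rho>)) * \<phi> ((t - b) / a)" for a b t
    unfolding E_def by (rule frac_wavelet_eq)
  define W where "W t a b = GNFrWT \<alpha> \<rho> \<phi> h a b * frac_wavelet \<alpha> \<rho> \<phi> a b t * of_real (\<bar>a\<bar> powr (2 * \<rho> - 3))" for t a b
  obtain \<phi>' where \<phi>': "L2_borel \<phi>'" "AE x in lborel. \<phi> x = \<phi>' x"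
    using assms(3) by (auto simp: wavelet_def elim: square_integrable_ex_borel)
  obtain h' where h': "L2_borel h'" "AE x in lborel. h x = h' x"
    using assms(4) by (auto elim: square_integrable_ex_borel)
  have [measurable]: "\<phi>' \<in> borel_measurable borel" "h' \<in> borel_measurable borel"
    using \<phi>' h' by measurable
  obtain \<Phi> where \<Phi>: "is_ft \<phi>' \<Phi>" "AE w in lborel. fourier_L2 \<phi> w = \<Phi> w"
    using fourier_L2_is_ft[OF \<phi>'] .
  have [measurable]: "\<Phi> \<in> borel_measurable borel" using is_ft_L2[OF \<Phi>(1)] by measurable
  define g where "g t = h' t * cnj (E t)" for t
  have [measurable]: "g \<in> borel_measurable borel" unfolding g_def[abs_def] by measurable
  have "L2_borel g"
    using h'(1) by (simp add: L2_borel_def g_def norm_mult E)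
  then obtain G where G: "is_ft g G" using is_ft_exists by blast
  have adm: "has_bochner_integral lborel (\<lambda>w. (cmod (\<Phi> w))\<^sup>2 / \<bar>w\<bar>) C"
  proof -
    have "AE w in lborel. (cmod (fourier_L2 \<phi> w))\<^sup>2 / \<bar>w\<bar> = (cmod (\<Phi> w))\<^sup>2 / \<bar>w\<bar>"
      using \<Phi>(2) by eventually_elim simp
    from lebesgue_AE_eq_borel(2,3)[OF _ this] show ?thesis
      using assms(3) by (simp add: has_bochner_integral_iff C_def C_adm_def wavelet_def)
  qed
  have C_pos: "0 < C" using assms(3) by (simp add: wavelet_def C_def)
  interpret calderon g G \<phi>' \<Phi> C
    using G \<Phi>(1) adm C_pos by unfold_locales
  have GN: "GNFrWT \<alpha> \<rho> \<phi> h a b = E b * of_real (\<bar>a\<bar> powr (- \<rho>)) * V a b" if a: "a \<noteq> 0" for a b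
  proof -
    have "AE t in lborel. \<phi> (- b / a + 1 / a * t) = \<phi>' (- b / a + 1 / a * t)"
      using a by (intro AE_lborel_affine[OF \<phi>'(2)]) simp
    then have "AE t in lborel. \<phi> ((t - b) / a) = \<phi>' ((t - b) / a)"
      unfolding affine_inverse .
    then have "AE t in lborel. h t * cnj (frac_wavelet \<alpha> \<rho> \<phi> a b t) =
        E b * of_real (\<bar>a\<bar> powr (- \<rho>)) * (g t * cnj (\<phi>' ((t - b) / a)))"
      using h'(2) unfolding fw g_def by eventually_elim (simp add: mult_ac)
    then have "GNFrWT \<alpha> \<rho> \<phi> h a b =
        (LINT t|lborel. E b * of_real (\<bar>a\<bar> powr (- \<rho>)) * (g t * cnj (\<phi>' ((t - b) / a))))"
      unfolding GNFrWT_def by (intro lebesgue_AE_eq_borel(3)) measurable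
    then show ?thesis unfolding V_def by (simp only: integral_mult_right_zero)
  qed
  \<comment> \<open>For almost every \<open>b\<close> only, because \<open>\<phi>\<close> is
    replaced by its representative \<open>\<phi>'\<close>. As a function of \<open>b\<close>,
    \<open>(t - b) / a\<close> is affine with slope \<open>- 1 / a\<close>, so preimages of null
    sets are null.\<close>
  have Weq: "AE b in lborel. W t a b = E t * of_real (1 / \<bar>a\<bar> ^ 3) * (V a b * \<phi>' ((t - b) / a))"
    if a: "a \<noteq> 0" for t a
  proof -
    have tb: "(t - b) / a = t / a + (- 1 / a) * b" for b by (simp add: diff_divide_distrib)
    have p: "\<bar>a\<bar> powr (- \<rho>) * \<bar>a\<bar> powr (- \<rho>) * \<bar>a\<bar> powr (2 * \<rho> - 3) = 1 / \<bar>a\<bar> ^ 3"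
    proof -
      have "\<bar>a\<bar> powr (- \<rho>) * \<bar>a\<bar> powr (- \<rho>) * \<bar>a\<bar> powr (2 * \<rho> - 3) = \<bar>a\<bar> powr (- 3)"
        by (simp flip: powr_add)
      also have "\<dots> = 1 / \<bar>a\<bar> ^ 3" using a by (simp add: powr_minus_divide powr_realpow)
      finally show ?thesis .
    qed
    have "AE b in lborel. \<phi> (t / a + (- 1 / a) * b) = \<phi>' (t / a + (- 1 / a) * b)"
      using a by (intro AE_lborel_affine[OF \<phi>'(2)]) simp
    then show ?thesis
    proof eventually_elim
      case (elim b)
      have "W t a b = (E b * cnj (E b)) * E t *
          of_real (\<bar>a\<bar> powr (- \<rho>) * \<bar>a\<bar> powr (- \<rho>) * \<bar>a\<bar> powr (2 * \<rho> - 3)) * (V a b * \<phi> ((t - b) / a))"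
        unfolding W_def GN[OF a] fw by (simp add: mult_ac)
      then show ?case unfolding p E(3) using elim unfolding tb by simp
    qed
  qed
  \<comment> \<open>The exceptional \<open>a\<close> come from \<open>K_L2\<close> and from
    \<open>a = 0\<close>, independently of \<open>t\<close>, so the quantifier over \<open>t\<close>
    stands inside. The factor \<open>\<bar>a\<bar> ^ 3\<close> of \<open>inner_integral\<close>
    cancels the weight left in \<open>Weq\<close>.\<close>
  have Wint: "AE a in lborel. \<forall>t. integrable lebesgue (W t a) \<and> (LINT b|lebesgue. W t a b) = E t * H t a"
    using AE_nonzero K_L2
  proof eventually_elim
    case (elim a)
    show ?case
    proof
      fix t
      have hb: "has_bochner_integral lborel (\<lambda>b. E t * of_real (1 / \<bar>a\<bar> ^ 3) * (V a b * \<phi>' ((t - b) / a)))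
          (E t * of_real (1 / \<bar>a\<bar> ^ 3) * (of_real (\<bar>a\<bar> ^ 3) * H t a))"
        by (rule has_bochner_integral_mult_right[OF inner_integral[OF elim]])
      also have "E t * of_real (1 / \<bar>a\<bar> ^ 3) * (of_real (\<bar>a\<bar> ^ 3) * H t a) = E t * H t a"
        using elim(1) by simp
      finally have hb: "has_bochner_integral lborel (\<lambda>b. E t * of_real (1 / \<bar>a\<bar> ^ 3) * (V a b * \<phi>' ((t - b) / a))) (E t * H t a)" .
      from lebesgue_AE_eq_borel(2,3)[OF _ Weq[OF elim(1)], of t] hb
      show "integrable lebesgue (W t a) \<and> (LINT b|lebesgue. W t a b) = E t * H t a"
        by (auto simp: has_bochner_integral_iff dest: borel_measurable_integrable)
    qed
  qed
  define I where "I t a = (LINT b|lebesgue. W t a b)" for t a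
  have I: "AE a in lborel. I t a = E t * H t a" for t
    using Wint by eventually_elim (simp add: I_def)
  have [measurable]: "H t \<in> borel_measurable borel" for t
    unfolding H_def[abs_def] by measurable
  have outer: "set_integrable lebesgue (away \<delta> \<epsilon>) (I t)"
    "1 / of_real C * (LINT a:away \<delta> \<epsilon>|lebesgue. I t a) = E t * R (away \<delta> \<epsilon>) t"
    if "\<delta> > 0" "\<epsilon> > 0" for \<delta> \<epsilon> t
  proof -
    have ae: "AE a in lborel. indicator (away \<delta> \<epsilon>) a *\<^sub>R I t a = E t * (indicator (away \<delta> \<epsilon>) a *\<^sub>R H t a)"
      using I[of t] by eventually_elim simp
    have "has_bochner_integral lborel (\<lambda>a. indicator (away \<delta> \<epsilon>) a *\<^sub>R H t a)
       (of_real (1 / (2 * pi)) * ft (\<lambda>w. G w * of_real (M (away \<delta> \<epsilon>) w)) (- t))"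
      using that away_bound by (intro outer_integral[of _ "min \<delta> \<epsilon>"]) auto
    from has_bochner_integral_mult_right[OF this, of "E t"] lebesgue_AE_eq_borel(2,3)[OF _ ae]
    show "set_integrable lebesgue (away \<delta> \<epsilon>) (I t)"
      "1 / of_real C * (LINT a:away \<delta> \<epsilon>|lebesgue. I t a) = E t * R (away \<delta> \<epsilon>) t"
      unfolding set_integrable_def set_lebesgue_integral_def
      by (simp_all add: has_bochner_integral_iff R_def)
  qed
  have L2R: "L2_borel (\<lambda>t. E t * R (away \<delta> \<epsilon>) t)" if "\<delta> > 0" "\<epsilon> > 0" for \<delta> \<epsilon>
  proof -
    have "L2_borel (R (away \<delta> \<epsilon>))"
      using that away_bound by (intro R_L2[of _ "min \<delta> \<epsilon>"]) auto
    then show ?thesis by (auto simp: L2_borel_def norm_mult E)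
  qed
  \<comment> \<open>The formula for the truncated integral requires positive cut-offs, which hold
    eventually along the filter.\<close>
  have pos: "\<forall>\<^sub>F x in at_right (0::real) \<times>\<^sub>F at_right (0::real). fst x > 0 \<and> snd x > 0"
    unfolding eventually_prod_filter
    by (intro exI[of _ "\<lambda>x. 0 < x"] conjI eventually_at_right_less) auto
  have "reconstructs C W h"
    unfolding reconstructs_def I_def[symmetric] away_def[symmetric]
  proof (intro conjI allI impI)
    show "AE a in lebesgue. integrable lebesgue (W t a)" for t
      using Wint by (simp add: AE_completion_iff) (auto elim: eventually_mono)
    show "set_integrable lebesgue (away \<delta> \<epsilon>) (I t)" if "\<delta> > 0" "\<epsilon> > 0" for t \<delta> \<epsilon>
      by (rule outer(1)[OF that])
    show "L2_tendsto (\<lambda>(\<delta>, \<epsilon>) t. 1 / of_real C * (LINT a:away \<delta> \<epsilon>|lebesgue. I t a)) h (at_right 0 \<times>\<^sub>F at_right 0)"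
      unfolding L2_tendsto_def
    proof (intro conjI assms(4))
      show "\<forall>\<^sub>F x in at_right 0 \<times>\<^sub>F at_right 0. square_integrable (case x of (\<delta>, \<epsilon>) \<Rightarrow> \<lambda>t. 1 / of_real C * (LINT a:away \<delta> \<epsilon>|lebesgue. I t a))"
        using pos
      proof eventually_elim
        case (elim x)
        then have "square_integrable (\<lambda>t. E t * R (away (fst x) (snd x)) t)"
          using L2R[of "fst x" "snd x"] square_integrable_AE_eq(1)[of "\<lambda>t. E t * R (away (fst x) (snd x)) t" "\<lambda>t. E t * R (away (fst x) (snd x)) t"]
          by (simp add: L2_borel_def)
        then show ?case
          by (simp only: case_prod_beta outer(2)[OF elim[THEN conjunct1] elim[THEN conjunct2]])
      qed
      have "((\<lambda>x. sqrt (case x of (\<delta>, \<epsilon>) \<Rightarrow> energy (\<lambda>t. R (away \<delta> \<epsilon>) t - g t))) \<longlongrightarrow> sqrt 0) (at_right 0 \<times>\<^sub>F at_right 0)"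
        by (rule tendsto_real_sqrt[OF R_tendsto])
      moreover have "\<forall>\<^sub>F x in at_right 0 \<times>\<^sub>F at_right 0. sqrt (case x of (\<delta>, \<epsilon>) \<Rightarrow> energy (\<lambda>t. R (away \<delta> \<epsilon>) t - g t)) =
          L2_norm (\<lambda>t. (case x of (\<delta>, \<epsilon>) \<Rightarrow> \<lambda>t. 1 / of_real C * (LINT a:away \<delta> \<epsilon>|lebesgue. I t a)) t - h t)"
        using pos
      proof eventually_elim
        case (elim x)
        let ?R = "R (away (fst x) (snd x))"
        have "(\<lambda>t. E t * ?R t) \<in> borel_measurable borel" using L2R elim by (simp add: L2_borel_def)
        then have "(\<lambda>t. E t * ?R t - h' t) \<in> borel_measurable borel" by measurable
        moreover have "AE t in lborel. E t * ?R t - h t = E t * ?R t - h' t"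
          using h'(2) by eventually_elim simp
        ultimately have "L2_norm (\<lambda>t. E t * ?R t - h t) = sqrt (energy (\<lambda>t. E t * ?R t - h' t))"
          by (rule square_integrable_AE_eq(2))
        \<comment> \<open>Since \<open>h' t = E t * g t\<close> with \<open>E\<close> unimodular,
          the chirp drops out of the error.\<close>
        also have "energy (\<lambda>t. E t * ?R t - h' t) = energy (\<lambda>t. ?R t - g t)"
        proof -
          have "E t * ?R t - h' t = E t * (?R t - g t)" for t
            using E(3)[of t] by (simp add: g_def right_diff_distrib mult.left_commute)
          then show ?thesis by (simp add: energy_def norm_mult E)
        qed
        finally show ?case
          by (simp only: case_prod_beta outer(2)[OF elim[THEN conjunct1] elim[THEN conjunct2]])
      qed
      ultimately show "((\<lambda>x. L2_norm (\<lambda>t. (case x of (\<delta>, \<epsilon>) \<Rightarrow> \<lambda>t. 1 / of_real C * (LINT a:away \<delta> \<epsilon>|lebesgue. I t a)) t - h t)) \<longlongrightarrow> 0) (at_right 0 \<times>\<^sub>F at_right 0)"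
        using Lim_transform_eventually by force
    qed
    have "AE t in lborel. integrable lebesgue (I t) \<longrightarrow> h t = 1 / of_real C * (LINT a|lebesgue. I t a)"
      using pointwise h'(2)
    proof eventually_elim
      case (elim t)
      show ?case
      proof
        assume int: "integrable lebesgue (I t)"
        note t = lebesgue_AE_eq_borel(2,3)[OF _ I, of t]
        \<comment> \<open>\<open>I t a\<close> equals \<open>E t * H t a\<close> for almost every
          \<open>a\<close>; multiplying by \<open>cnj (E t)\<close> removes the chirp, so that
          \<open>pointwise\<close> applies.\<close>
        have "integrable lborel (\<lambda>a. E t * H t a)" using t(1) int by simp
        from integrable_mult_right[OF this, of "cnj (E t)"] have "integrable lborel (H t)"
          by (simp add: E flip: mult.assoc)
        with elim have gt: "g t = of_real (1 / C) * (LINT a|lborel. H t a)" by simp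
        have "h t = E t * g t" using elim(2) E(3)[of t] by (simp add: g_def mult.left_commute)
        also have "\<dots> = 1 / of_real C * (LINT a|lborel. E t * H t a)" by (simp add: gt)
        also have "\<dots> = 1 / of_real C * (LINT a|lebesgue. I t a)" using t(2) by simp
        finally show "h t = 1 / of_real C * (LINT a|lebesgue. I t a)" .
      qed
    qed
    then show "AE t in lebesgue. integrable lebesgue (I t) \<longrightarrow> h t = 1 / of_real C * (LINT a|lebesgue. I t a)"
      by (simp add: AE_completion_iff)
  qed
  then show ?thesis by (simp add: C_def W_def[abs_def])
qed

end
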